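(* Let $d\ge 3$ be an odd integer such that either $d=4l+1$ for some $l\in\mathbb{N}$, or $d=4l-1$ for some $l\in\mathbb{N}$ and $q\equiv 1 \pmod 4$. (i) For any integer $k>3$, there exists a constant $C_k'>0$ such that for every primitive element $j$ of $\mathbb{F}_q^*$ and every subset $A$ of $S_j^{d-1}$ with $|A|\ge C_k' q^{\frac{d-1}{2}+\frac{1}{4(k-\frac{3}{2})}}$, one has $$|\Delta_k(A)| \gg q.$$ (ii) There exists a constant $C_3'>0$ such that for every primitive element $j$ of $\mathbb{F}_q^*$ and every subset $A$ of $S_j^{d-1}$ with $|A|\ge C_3' q^{\frac{d}{2}-\frac{1}{3}}$, one has $$|\Delta_3(A)| \gg q.$$ Here the constants $C_k'$ and $C_3'$ do not depend on $q$, $j$ or $A$.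
   Context: $\mathbb{F}_q$ is a finite field with $q$ elements, where $q$ is an odd prime power. An element $g\in\mathbb{F}_q$ is primitive if it generates the multiplicative group $\mathbb{F}_q^*$. For $x=(x_1,\dots,x_d)\in\mathbb{F}_q^d$ write $\|x\|=x_1^2+\cdots+x_d^2\in\mathbb{F}_q$. For $j\in\mathbb{F}_q$, $S_j^{d-1}=\{x\in\mathbb{F}_q^d : \|x\|=j\}$ is the sphere centered at the origin of radius $j$. For $A\subseteq \mathbb{F}_q^d$ and an integer $k\ge 2$, $\Delta_k(A)=\{\|x^1+\cdots+x^k\| : x^i\in A,\ 1\le i\le k\}\subseteq\mathbb{F}_q$. For a finite set $X$, $|X|$ denotes its cardinality. The notation $X\ll Y$ (equivalently $Y\gg X$) means that there is an absolute constant $C_1>0$ such that $X\le C_1Y$. *)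

theory Defs
  imports Complex_Main "HOL-Algebra.Algebra"
begin

text \<open>
  Finite fields are HOL-Algebra fields \<open>R :: 'a ring\<close> with finite carrier, so that one can quantify
  over all of them inside a formula: the constants must not depend on the field, hence they have
  to be chosen before \<open>R\<close>. Every finite field is isomorphic to one with carrier in any given
  infinite type, so for infinite \<open>'a\<close> (e.g. \<open>nat\<close>) this ranges over all finite fields.
\<close>

definition primitive_elem :: "'a ring \<Rightarrow> 'a \<Rightarrow> bool" where
  "primitive_elem R g \<longleftrightarrow>
     g \<in> carrier (mult_of R) \<and> generate (mult_of R) {g} = carrier (mult_of R)"

definition vecs :: "'a ring \<Rightarrow> nat \<Rightarrow> (nat \<Rightarrow> 'a) set" where
  "vecs R d = (\<Pi>\<^sub>E i\<in>{1..d}. carrier R)"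

definition sqnorm :: "'a ring \<Rightarrow> nat \<Rightarrow> (nat \<Rightarrow> 'a) \<Rightarrow> 'a" where
  "sqnorm R d x = (\<Oplus>\<^bsub>R\<^esub>i\<in>{1..d}. x i [^]\<^bsub>R\<^esub> (2::nat))"

definition sphere :: "'a ring \<Rightarrow> nat \<Rightarrow> 'a \<Rightarrow> (nat \<Rightarrow> 'a) set" where
  "sphere R d j = {x \<in> vecs R d. sqnorm R d x = j}"

definition vec_sum :: "'a ring \<Rightarrow> nat \<Rightarrow> nat \<Rightarrow> (nat \<Rightarrow> nat \<Rightarrow> 'a) \<Rightarrow> nat \<Rightarrow> 'a" where
  "vec_sum R d k P = (\<lambda>i\<in>{1..d}. \<Oplus>\<^bsub>R\<^esub>m\<in>{1..k}. P m i)"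

text \<open>The points \<open>P 1, \<dots>, P k\<close> of \<open>A\<close> need not be distinct.\<close>

definition Delta :: "'a ring \<Rightarrow> nat \<Rightarrow> nat \<Rightarrow> (nat \<Rightarrow> 'a) set \<Rightarrow> 'a set" where
  "Delta R d k A = {sqnorm R d (vec_sum R d k P) | P. \<forall>m\<in>{1..k}. P m \<in> A}"

definition admissible :: "nat \<Rightarrow> nat \<Rightarrow> bool" where
  "admissible d q \<longleftrightarrow>
     (\<exists>l::nat. d = 4 * l + 1) \<or> ((\<exists>l::nat. d + 1 = 4 * l) \<and> q mod 4 = 1)"

end

theory Submission
  imports Defs
begin

text \<open>
  Everything is an exact count with the quadratic character \<open>eta\<close>; no additive characters are
  needed. For odd \<open>d\<close> a sphere of squared radius \<open>r\<close> has \<open>q\<^bsup>d-1\<^esup> \<plusminus> q\<^bsup>(d-1)/2\<^esup> eta r\<close> points. A primitive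
  \<open>j\<close> is a nonsquare, and the hypothesis on \<open>d\<close> then makes the quadric \<open>\<parallel>x\<parallel> = j t\<^sup>2\<close> elliptic. As a
  consequence every hyperplane section of \<open>S = S\<^sub>j\<close> has at most \<open>q\<^bsup>d-2\<^esup> + q\<^bsup>(d-3)/2\<^esup>\<close> points: the large
  error terms, which come from tangent hyperplanes, are negative and may be dropped.

  Let \<open>E\<^sub>n\<close> be the number of solutions of \<open>x\<^sub>1 + \<dots> + x\<^sub>n = y\<^sub>1 + \<dots> + y\<^sub>n\<close> in \<open>A \<subseteq> S\<close> and \<open>a = |A|\<close>. Second moments
  over \<open>S\<close> and the section bound give \<open>E\<^sub>n\<^sub>+\<^sub>1 \<le> 5 a\<^bsup>2n+1\<^esup>/q + q\<^bsup>d-1\<^esup> E\<^sub>n\<close>. For \<open>E\<^sub>2\<close> one counts right angles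
  \<open>(x - z) \<cdot> (y - z) = 0\<close>, and a point-hyperplane incidence bound in projective space gives
  \<open>E\<^sub>2 \<le> a\<^sup>3/q + 8 q\<^bsup>(d-2)/2\<^esup> a\<^sup>2\<close>, provided that few pairs of points of \<open>A\<close> lie on a common line inside \<open>S\<close>;
  ellipticity guarantees this. Finally, a variance over the last summand \<open>x \<in> S\<close> bounds the average
  over \<open>x \<in> A\<close> of the number of coincidences \<open>\<parallel>u + x\<parallel> = \<parallel>u' + x\<parallel>\<close> by \<open>3 a\<^bsup>2n\<^esup>/q + q\<^bsup>d-1\<^esup> E\<^sub>n/a\<close>, where \<open>n = k - 1\<close>, and
  the Cauchy-Schwarz inequality for a good \<open>x\<close> concludes.
\<close>

section \<open>Double counting\<close>

lemma sum_card_swap: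
  assumes "finite A" "finite B"
  shows "(\<Sum>a\<in>A. real (card {b \<in> B. P a b})) = (\<Sum>b\<in>B. real (card {a \<in> A. P a b}))"
proof -
  have "real (card {b \<in> B. P a b}) = (\<Sum>b\<in>B. of_bool (P a b))" for a
    using assms by (simp add: sum_of_bool_eq Int_def)
  moreover have "real (card {a \<in> A. P a b}) = (\<Sum>a\<in>A. of_bool (P a b))" for b
    using assms by (simp add: sum_of_bool_eq Int_def)
  ultimately show ?thesis by (simp only:) (rule sum.swap)
qed

text \<open>The square of a count is a count of pairs, so second moments reduce to joint incidences
  of two elements.\<close>

lemma sum_card_square:
  assumes "finite A" "finite B"
  shows "(\<Sum>b\<in>B. (real (card {a \<in> A. P a b}))\<^sup>2) =
    (\<Sum>a\<in>A. \<Sum>a'\<in>A. real (card {b \<in> B. P a b \<and> P a' b}))"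
proof -
  have "(real (card {a \<in> A. P a b}))\<^sup>2 = (\<Sum>p\<in>A\<times>A. of_bool (P (fst p) b \<and> P (snd p) b))" for b
  proof -
    have "{p \<in> A \<times> A. P (fst p) b \<and> P (snd p) b} = {a \<in> A. P a b} \<times> {a \<in> A. P a b}" by auto
    then have "(\<Sum>p\<in>A\<times>A. of_bool (P (fst p) b \<and> P (snd p) b)) = real (card ({a \<in> A. P a b} \<times> {a \<in> A. P a b}))"
      using assms by (simp add: sum_of_bool_eq Int_def)
    then show ?thesis by (simp add: card_cartesian_product power2_eq_square)
  qed
  moreover have "real (card {b \<in> B. P a b \<and> P a' b}) = (\<Sum>b\<in>B. of_bool (P a b \<and> P a' b))" for a a'
    using assms by (simp add: sum_of_bool_eq Int_def)
  ultimately have "(\<Sum>b\<in>B. (real (card {a \<in> A. P a b}))\<^sup>2) = 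
      (\<Sum>p\<in>A\<times>A. \<Sum>b\<in>B. of_bool (P (fst p) b \<and> P (snd p) b))"
    by (simp only:) (rule sum.swap)
  also have "\<dots> = (\<Sum>p\<in>A\<times>A. real (card {b \<in> B. P (fst p) b \<and> P (snd p) b}))"
    using assms by (simp add: sum_of_bool_eq Int_def)
  also have "\<dots> = (\<Sum>a\<in>A. \<Sum>a'\<in>A. real (card {b \<in> B. P a b \<and> P a' b}))"
    by (simp add: sum.cartesian_product case_prod_unfold)
  finally show ?thesis .
qed

lemma sum_squared_deviation:
  fixes f :: "'b \<Rightarrow> real"
  shows "(\<Sum>y\<in>Y. (f y - c)\<^sup>2) = (\<Sum>y\<in>Y. (f y)\<^sup>2) - 2 * c * (\<Sum>y\<in>Y. f y) + real (card Y) * c\<^sup>2"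
proof -
  have "(f y - c)\<^sup>2 = (f y)\<^sup>2 - (2 * c) * f y + c\<^sup>2" for y by (simp add: power2_diff)
  then have "(\<Sum>y\<in>Y. (f y - c)\<^sup>2) = (\<Sum>y\<in>Y. (f y)\<^sup>2) - (\<Sum>y\<in>Y. (2 * c) * f y) + (\<Sum>y\<in>Y. c\<^sup>2)"
    by (simp only: sum.distrib sum_subtractf)
  then show ?thesis by (simp only: sum_distrib_left[symmetric] sum_constant)
qed

lemma sum_card_fibres:
  fixes h :: "'b \<Rightarrow> real"
  assumes "finite Z" "finite Y" "\<And>p. p \<in> Z \<Longrightarrow> f p \<in> Y"
  shows "(\<Sum>u\<in>Y. real (card {p \<in> Z. f p = u}) * h u) = (\<Sum>p\<in>Z. h (f p))"
proof -
  have "(\<Sum>p\<in>Z. h (f p)) = (\<Sum>u\<in>Y. \<Sum>p\<in>{p \<in> Z. f p = u}. h (f p))"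
    using assms by (intro sum.group[symmetric]) auto
  also have "\<dots> = (\<Sum>u\<in>Y. real (card {p \<in> Z. f p = u}) * h u)" by (intro sum.cong) auto
  finally show ?thesis by simp
qed

lemma sum_card_Sigma: "finite A \<Longrightarrow> finite B \<Longrightarrow>
  (\<Sum>a\<in>A. real (card {b \<in> B. P a b})) = real (card {p \<in> A \<times> B. P (fst p) (snd p)})"
proof -
  assume "finite A" "finite B"
  moreover have "{p \<in> A \<times> B. P (fst p) (snd p)} = (SIGMA a:A. {b \<in> B. P a b})" by auto
  ultimately show ?thesis by simp
qed

text \<open>Cauchy-Schwarz in the form of a weighted arithmetic-geometric mean: no square roots
  appear, and each use picks a convenient weight \<open>k\<close>.\<close>

lemma sum_mult_le_weighted_squares:
  fixes g h :: "'b \<Rightarrow> real"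
  assumes "k > 0"
  shows "(\<Sum>u\<in>Y. g u * h u) \<le> (k * (\<Sum>u\<in>Y. (g u)\<^sup>2) + (\<Sum>u\<in>Y. (h u)\<^sup>2) / k) / 2"
proof -
  have "x * y \<le> (k * x\<^sup>2 + y\<^sup>2 / k) / 2" for x y :: real
  proof -
    have "0 \<le> (k * x - y)\<^sup>2 / k" using assms by simp
    also have "\<dots> = k * x\<^sup>2 + y\<^sup>2 / k - 2 * (x * y)"
      using assms by (simp add: power2_diff field_simps power2_eq_square)
    finally show ?thesis by simp
  qed
  then have "(\<Sum>u\<in>Y. g u * h u) \<le> (\<Sum>u\<in>Y. (k * (g u)\<^sup>2 + (h u)\<^sup>2 / k) / 2)" by (intro sum_mono)
  also have "\<dots> = (k * (\<Sum>u\<in>Y. (g u)\<^sup>2) + (\<Sum>u\<in>Y. (h u)\<^sup>2) / k) / 2"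
    by (simp add: sum.distrib sum_distrib_left sum_divide_distrib[symmetric])
  finally show ?thesis .
qed

text \<open>Expanding the square gives a sum over pairs \<open>b\<close>, \<open>c\<close> of joint
  incidences. Each \<open>P b\<close> cuts out a set of size at most \<open>s\<close>, and two
  different ones meet in at most \<open>t\<close> points.\<close>

lemma weighted_collisions_le:
  fixes f :: "'b \<Rightarrow> real" and s t :: real
  assumes fin: "finite W" "finite Y" and nonneg: "\<And>b. b \<in> W \<Longrightarrow> f b \<ge> 0"
    and diag: "\<And>b. b \<in> W \<Longrightarrow> real (card {y \<in> Y. P b y}) \<le> s"
    and off: "\<And>b c. b \<in> W \<Longrightarrow> c \<in> W \<Longrightarrow> b \<noteq> c \<Longrightarrow> real (card {y \<in> Y. P b y \<and> P c y}) \<le> t"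
    and t: "t \<ge> 0"
  shows "(\<Sum>y\<in>Y. (\<Sum>b\<in>W. f b * of_bool (P b y))\<^sup>2) \<le> s * (\<Sum>b\<in>W. (f b)\<^sup>2) + t * (\<Sum>b\<in>W. f b)\<^sup>2"
proof -
  have "(\<Sum>b\<in>W. f b * of_bool (P b y))\<^sup>2 = (\<Sum>p\<in>W\<times>W. f (fst p) * f (snd p) * of_bool (P (fst p) y \<and> P (snd p) y))" for y
    unfolding power2_eq_square sum_product sum.cartesian_product case_prod_unfold
    by (intro sum.cong) auto
  then have "(\<Sum>y\<in>Y. (\<Sum>b\<in>W. f b * of_bool (P b y))\<^sup>2) =
      (\<Sum>p\<in>W\<times>W. \<Sum>y\<in>Y. f (fst p) * f (snd p) * of_bool (P (fst p) y \<and> P (snd p) y))"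
    by (simp only:) (rule sum.swap)
  also have "\<dots> = (\<Sum>p\<in>W\<times>W. f (fst p) * f (snd p) * real (card {y \<in> Y. P (fst p) y \<and> P (snd p) y}))"
    using fin by (simp add: sum_of_bool_eq Int_def flip: sum_distrib_left)
  \<comment> \<open>Charging \<open>t\<close> on the diagonal as well, harmless since
    \<open>t\<close> is nonnegative, lets the off-diagonal part factor into the square of a
    sum.\<close>
  also have "\<dots> \<le> (\<Sum>p\<in>W\<times>W. f (fst p) * f (snd p) * (t + s * of_bool (fst p = snd p)))"
  proof (intro sum_mono mult_left_mono)
    fix p assume p: "p \<in> W \<times> W"
    then show "0 \<le> f (fst p) * f (snd p)" using nonneg by auto
    show "real (card {y \<in> Y. P (fst p) y \<and> P (snd p) y}) \<le> t + s * of_bool (fst p = snd p)"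
      using diag[of "fst p"] off[of "fst p" "snd p"] t p by (cases "fst p = snd p") auto
  qed
  also have "\<dots> = (\<Sum>b\<in>W. \<Sum>c\<in>W. t * (f b * f c) + s * (f b * f c * of_bool (b = c)))"
    unfolding sum.cartesian_product case_prod_unfold by (intro sum.cong) (simp_all only: distrib_left mult_ac)
  also have "\<dots> = t * (\<Sum>b\<in>W. \<Sum>c\<in>W. f b * f c) + s * (\<Sum>b\<in>W. \<Sum>c\<in>W. f b * f c * of_bool (b = c))"
    by (simp only: sum.distrib sum_distrib_left)
  also have "(\<Sum>b\<in>W. \<Sum>c\<in>W. f b * f c) = (\<Sum>b\<in>W. f b)\<^sup>2"
    by (simp add: power2_eq_square sum_product)
  also have "(\<Sum>b\<in>W. \<Sum>c\<in>W. f b * f c * of_bool (b = c)) = (\<Sum>b\<in>W. (f b)\<^sup>2)"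
  proof (rule sum.cong)
    fix b assume "b \<in> W"
    have "(\<Sum>c\<in>W. f b * f c * of_bool (b = c)) = (\<Sum>c\<in>W. if b = c then (f b)\<^sup>2 else 0)"
      by (intro sum.cong) (auto simp: power2_eq_square)
    then show "(\<Sum>c\<in>W. f b * f c * of_bool (b = c)) = (f b)\<^sup>2" using \<open>b \<in> W\<close> fin by simp
  qed simp
  finally show ?thesis by simp
qed

section \<open>The quadratic character and the size of spheres\<close>

locale odd_finite_field = field R for R :: "'a ring" (structure) +
  assumes finite_carrier: "finite (carrier R)" and odd_order: "odd (order R)"
begin

declare finite_carrier [simp]

abbreviation F where "F \<equiv> carrier R"
abbreviation q :: real where "q \<equiv> real (order R)"

text \<open>The quadratic character with value 0 at zero. Counting square roots makes
  \<open>1 + eta r\<close> the multiplicity of \<open>r\<close> among the squares, which is how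
  character sums arise from point counts.\<close>

definition eta :: "'a \<Rightarrow> real" where
  "eta r = real (card {t \<in> F. t \<otimes> t = r}) - 1"

lemma card_carrier: "real (card F) = q"
  by (simp add: order_def)

lemma q_ge_3: "q \<ge> 3"
proof -
  have "card {\<zero>, \<one>} \<le> card F" using finite_carrier by (intro card_mono) auto
  then have "order R \<ge> 2" by (simp add: order_def)
  with odd_order have "order R \<noteq> 2" "order R \<ge> 2" by auto
  then show ?thesis by linarith
qed

text \<open>In characteristic 2 the additive order of \<open>\<one>\<close> would be 2 and would
  divide the odd number of elements.\<close>

lemma one_plus_one: "\<one> \<oplus> \<one> \<noteq> \<zero>"
proof
  assume two: "\<one> \<oplus> \<one> = \<zero>"
  let ?o = "group.ord (add_monoid R) \<one>"
  have "\<one> [^]\<^bsub>add_monoid R\<^esub> (2::nat) = \<one>\<^bsub>add_monoid R\<^esub>"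
    using two by (simp add: numeral_2_eq_2)
  then have dvd: "?o dvd 2" using group.pow_eq_id[OF a_group, of \<one> 2] by simp
  then have "?o \<le> 2" by (rule dvd_imp_le) simp
  moreover have "?o \<noteq> 0" using dvd by (metis dvd_0_left_iff zero_neq_numeral)
  moreover have "?o \<noteq> 1" using group.ord_eq_1[OF a_group, of \<one>] by simp
  ultimately have "?o = 2" by linarith
  moreover have "?o dvd order (add_monoid R)"
    using group.ord_dvd_group_order[OF a_group, of \<one>] by simp
  ultimately have "2 dvd order (add_monoid R)" by simp
  then show False using odd_order by (simp add: order_def)
qed

lemma double_eq_zero: "x \<in> F \<Longrightarrow> x \<oplus> x = \<zero> \<longleftrightarrow> x = \<zero>"
proof
  assume x: "x \<in> F" "x \<oplus> x = \<zero>"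
  have "(\<one> \<oplus> \<one>) \<otimes> x = \<zero>" using x by (simp add: l_distr)
  then show "x = \<zero>" using x one_plus_one integral by blast
qed simp

lemma minus_self: "x \<in> F \<Longrightarrow> x = \<ominus> x \<longleftrightarrow> x = \<zero>"
  by (metis double_eq_zero r_neg minus_zero)

lemma square_eq_iff: "s \<in> F \<Longrightarrow> t \<in> F \<Longrightarrow> s \<otimes> s = t \<otimes> t \<longleftrightarrow> s = t \<or> s = \<ominus> t"
proof
  assume F: "s \<in> F" "t \<in> F" and eq: "s \<otimes> s = t \<otimes> t"
  have "(s \<ominus> t) \<otimes> (s \<oplus> t) = s \<otimes> s \<ominus> t \<otimes> t" using F by algebra
  then have "(s \<ominus> t) \<otimes> (s \<oplus> t) = \<zero>" using eq F by (simp add: r_neg minus_eq)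
  then have "s \<ominus> t = \<zero> \<or> s \<oplus> t = \<zero>" using F integral by blast
  then show "s = t \<or> s = \<ominus> t" using F by (metis minus_equality minus_eq r_right_minus_eq)
qed (auto simp: l_minus r_minus)

lemma square_roots: "s \<in> F \<Longrightarrow> {t \<in> F. t \<otimes> t = s \<otimes> s} = {s, \<ominus> s}"
  by (auto simp: square_eq_iff l_minus r_minus)

lemma eta_square: "s \<in> F \<Longrightarrow> eta (s \<otimes> s) = (if s = \<zero> then 0 else 1)"
  using minus_self[of s] by (simp add: eta_def square_roots)

lemma eta_zero [simp]: "eta \<zero> = 0"
  using eta_square[of \<zero>] by simp

lemma eta_nonsquare: "\<nexists>s. s \<in> F \<and> r = s \<otimes> s \<Longrightarrow> eta r = -1"
proof -
  assume "\<nexists>s. s \<in> F \<and> r = s \<otimes> s"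
  then have empty: "{t \<in> F. t \<otimes> t = r} = {}" by auto
  show "eta r = -1" unfolding eta_def empty by simp
qed

lemma eta_one [simp]: "eta \<one> = 1"
  using eta_square[of \<one>] by simp

lemma eta_cases: "r = \<zero> \<or> eta r = 1 \<or> eta r = -1"
proof (cases "\<exists>s. s \<in> F \<and> r = s \<otimes> s")
  case True
  then obtain s where "s \<in> F" "r = s \<otimes> s" by blast
  then show ?thesis using eta_square[of s] by (cases "s = \<zero>") auto
qed (use eta_nonsquare in blast)

lemma sum_over_squares:
  "(\<Sum>t\<in>F. f (t \<otimes> t)) = (\<Sum>r\<in>F. (1 + eta r) * f r)" for f :: "'a \<Rightarrow> real"
proof -
  have "(\<Sum>t\<in>F. f (t \<otimes> t)) = (\<Sum>r\<in>F. \<Sum>t\<in>{t \<in> F. t \<otimes> t = r}. f (t \<otimes> t))"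
    by (rule sum.group[symmetric]) auto
  also have "\<dots> = (\<Sum>r\<in>F. (1 + eta r) * f r)" by (intro sum.cong) (auto simp: eta_def)
  finally show ?thesis .
qed

lemma sum_eta: "(\<Sum>r\<in>F. eta r) = 0"
  using sum_over_squares[of "\<lambda>_. 1"] by (simp add: sum.distrib)

text \<open>Since \<open>eta\<close> sums to zero, its values 1 and -1 are taken equally often, and
  together they occupy all nonzero elements.\<close>

lemma card_squares: "2 * real (card {r \<in> F. eta r = 1}) = q - 1"
  and card_nonsquares: "2 * real (card {r \<in> F. eta r = -1}) = q - 1"
proof -
  let ?P = "{r \<in> F. eta r = 1}" and ?N = "{r \<in> F. eta r = -1}"
  have split: "F = insert \<zero> (?P \<union> ?N)"
  proof (rule Set.set_eqI)
    show "r \<in> F \<longleftrightarrow> r \<in> insert \<zero> (?P \<union> ?N)" for r using eta_cases[of r] by auto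
  qed
  have fin: "finite ?P" "finite ?N" by simp_all
  have disj: "?P \<inter> ?N = {}" by (simp add: disjoint_iff)
  have "\<zero> \<notin> ?P \<union> ?N" by simp
  note parts = fin disj this
  have "card F = card (insert \<zero> (?P \<union> ?N))" using arg_cong[OF split, of card] .
  also have "\<dots> = 1 + card (?P \<union> ?N)" using parts by simp
  also have "card (?P \<union> ?N) = card ?P + card ?N" using parts by (intro card_Un_disjoint)
  finally have "card F = 1 + (card ?P + card ?N)" .
  note cards = this
  have "(\<Sum>r\<in>F. eta r) = (\<Sum>r\<in>insert \<zero> (?P \<union> ?N). eta r)"
    using arg_cong[OF split, of "sum eta"] .
  also have "\<dots> = (\<Sum>r\<in>?P \<union> ?N. eta r)" using parts by simp
  also have "\<dots> = (\<Sum>r\<in>?P. eta r) + (\<Sum>r\<in>?N. eta r)" using parts by (intro sum.union_disjoint)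
  also have "\<dots> = real (card ?P) - real (card ?N)" by simp
  finally show "2 * real (card ?P) = q - 1" "2 * real (card ?N) = q - 1"
    using sum_eta card_carrier cards by linarith+
qed

text \<open>Multiplication by \<open>c\<close> maps the nonzero squares injectively into the
  nonsquares; the two classes have equal size, so it is onto.\<close>

lemma nonsquare_decomposition:
  assumes "c \<in> F" "eta c = -1" "r \<in> F" "eta r = -1"
  shows "\<exists>s\<in>F. r = c \<otimes> (s \<otimes> s)"
proof -
  let ?P = "{r \<in> F. eta r = 1}" and ?N = "{r \<in> F. eta r = -1}"
  have c0: "c \<noteq> \<zero>" using assms by auto
  have "(\<lambda>x. c \<otimes> x) ` ?P \<subseteq> ?N"
  proof safe
    fix x assume x: "x \<in> F" "eta x = 1"
    then obtain s where s: "s \<in> F" "x = s \<otimes> s" using eta_nonsquare[of x] by fastforce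
    have s0: "s \<noteq> \<zero>" using s x by auto
    have "\<nexists>t. t \<in> F \<and> c \<otimes> x = t \<otimes> t"
    proof
      assume "\<exists>t. t \<in> F \<and> c \<otimes> x = t \<otimes> t"
      then obtain t where t: "t \<in> F" "c \<otimes> x = t \<otimes> t" by auto
      have i: "inv s \<in> F" "s \<otimes> inv s = \<one>" using s s0 field_Units by auto
      have "c = c \<otimes> ((s \<otimes> inv s) \<otimes> (s \<otimes> inv s))" using i assms by simp
      also have "\<dots> = (c \<otimes> x) \<otimes> (inv s \<otimes> inv s)"
        using s i(1) assms by (simp add: m_ac)
      also have "\<dots> = (t \<otimes> inv s) \<otimes> (t \<otimes> inv s)" using t i(1) by (simp add: m_ac)
      finally show False using eta_square[of "t \<otimes> inv s"] t i assms by (auto split: if_splits)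
    qed
    then show "eta (c \<otimes> x) = -1" by (rule eta_nonsquare)
  qed (use assms in auto)
  moreover have "card ((\<lambda>x. c \<otimes> x) ` ?P) = card ?P"
    by (intro card_image inj_onI) (use assms c0 m_lcancel in auto)
  moreover have "card ?P = card ?N" using card_squares card_nonsquares by linarith
  ultimately have "(\<lambda>x. c \<otimes> x) ` ?P = ?N"
    by (intro card_subset_eq) auto
  then obtain x where x: "x \<in> F" "eta x = 1" "r = c \<otimes> x" using assms by blast
  then obtain s where "s \<in> F" "x = s \<otimes> s" using eta_nonsquare[of x] by fastforce
  with x show ?thesis by blast
qed

lemma eta_mult_square: "a \<in> F \<Longrightarrow> s \<in> F \<Longrightarrow> s \<noteq> \<zero> \<Longrightarrow> eta (a \<otimes> (s \<otimes> s)) = eta a"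
proof -
  assume a: "a \<in> F" "s \<in> F" "s \<noteq> \<zero>"
  have i: "inv s \<in> F" "s \<otimes> inv s = \<one>" "inv s \<otimes> s = \<one>" using a field_Units by auto
  have "bij_betw (\<lambda>t. t \<otimes> s) {t \<in> F. t \<otimes> t = a} {t \<in> F. t \<otimes> t = a \<otimes> (s \<otimes> s)}"
  proof (rule bij_betwI[where g = "\<lambda>t. t \<otimes> inv s"])
    show "(\<lambda>t. t \<otimes> s) \<in> {t \<in> F. t \<otimes> t = a} \<rightarrow> {t \<in> F. t \<otimes> t = a \<otimes> (s \<otimes> s)}"
      using a by (auto simp: m_ac)
    have "(t \<otimes> inv s) \<otimes> (t \<otimes> inv s) = a" if "t \<in> F" "t \<otimes> t = a \<otimes> (s \<otimes> s)" for t
    proof -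
      have "(t \<otimes> inv s) \<otimes> (t \<otimes> inv s) = (t \<otimes> t) \<otimes> (inv s \<otimes> inv s)" using that(1) i(1) by (simp add: m_ac)
      also have "\<dots> = a \<otimes> ((s \<otimes> inv s) \<otimes> (s \<otimes> inv s))" using that a i(1) by (simp add: m_ac)
      finally show ?thesis using a i by simp
    qed
    then show "(\<lambda>t. t \<otimes> inv s) \<in> {t \<in> F. t \<otimes> t = a \<otimes> (s \<otimes> s)} \<rightarrow> {t \<in> F. t \<otimes> t = a}"
      using i by auto
  qed (use a i in \<open>auto simp: m_assoc\<close>)
  then show ?thesis by (simp add: eta_def bij_betw_same_card)
qed

text \<open>Square factors are harmless; for two nonsquares \<open>b = a s^2\<close>, so the product
  is the square of \<open>a s\<close>.\<close>

lemma eta_mult: 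
  assumes "a \<in> F" "b \<in> F" shows "eta (a \<otimes> b) = eta a * eta b"
proof -
  consider s where "s \<in> F" "b = s \<otimes> s" | s where "s \<in> F" "a = s \<otimes> s"
    | "eta a = -1" "eta b = -1"
    using eta_nonsquare by blast
  then show ?thesis
  proof cases
    case 1
    then show ?thesis using eta_mult_square[of a s] eta_square[of s] assms by auto
  next
    case 2
    then show ?thesis using eta_mult_square[of b s] eta_square[of s] assms by (auto simp: m_comm)
  next
    case 3
    then obtain s where s: "s \<in> F" "b = a \<otimes> (s \<otimes> s)"
      using nonsquare_decomposition assms by metis
    then have "a \<otimes> b = (a \<otimes> s) \<otimes> (a \<otimes> s)" using assms by (simp add: m_ac)
    moreover have "a \<noteq> \<zero>" "s \<noteq> \<zero>" using s 3 assms by auto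
    ultimately show ?thesis using eta_square[of "a \<otimes> s"] 3 s assms integral by auto
  qed
qed

lemma eta_nonzero: "r \<in> F \<Longrightarrow> r \<noteq> \<zero> \<Longrightarrow> eta r * eta r = 1"
  by (metis eta_mult eta_square)

section \<open>Jacobi sums of the quadratic character\<close>

lemma sum_shift: "c \<in> F \<Longrightarrow> (\<Sum>u\<in>F. f (c \<ominus> u)) = (\<Sum>u\<in>F. f u)" for f :: "'a \<Rightarrow> real"
  by (rule sum.reindex_bij_witness[where i="\<lambda>u. c \<ominus> u" and j="\<lambda>u. c \<ominus> u"])
     (simp_all add: minus_eq minus_add a_assoc[symmetric] r_neg)

lemma divide_divide:
  assumes "r \<in> F" "u \<in> F" "r \<noteq> \<zero>" "u \<noteq> \<zero>"
  shows "r \<otimes> inv u \<in> F - {\<zero>}" "r \<otimes> inv (r \<otimes> inv u) = u"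
proof -
  have i: "inv u \<in> F" "inv r \<in> F" "u \<otimes> inv u = \<one>" "r \<otimes> inv r = \<one>" "inv u \<noteq> \<zero>"
    using assms field_Units nonzero_imp_inverse_nonzero by auto
  then show "r \<otimes> inv u \<in> F - {\<zero>}" using assms integral by auto
  have "(r \<otimes> inv u) \<otimes> (inv r \<otimes> u) = (r \<otimes> inv r) \<otimes> (u \<otimes> inv u)"
    using i(1,2) assms by (simp add: m_ac)
  then have "inv (r \<otimes> inv u) = inv r \<otimes> u" using i assms by (intro comm_inv_char) auto
  then have "r \<otimes> inv (r \<otimes> inv u) = (r \<otimes> inv r) \<otimes> u" using i(2) assms by (simp add: m_assoc)
  then show "r \<otimes> inv (r \<otimes> inv u) = u" using i assms by simp
qed

text \<open>For \<open>r = \<zero>\<close> each nonzero \<open>u\<close> contributes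
  \<open>eta (\<ominus> \<one>)\<close>. Otherwise pulling \<open>u\<close> out of
  \<open>r - u\<close> removes both occurrences of \<open>eta u\<close>, and sending
  \<open>u\<close> to \<open>r/u - 1\<close> maps the nonzero elements onto everything except -1;
  what remains is the vanishing full sum of \<open>eta\<close> minus its term at -1.\<close>

lemma jacobi_sum:
  assumes "r \<in> F"
  shows "(\<Sum>u\<in>F. eta u * eta (r \<ominus> u)) = eta (\<ominus> \<one>) * (if r = \<zero> then q - 1 else -1)"
proof -
  have F0: "(\<Sum>u\<in>F. g u) = (\<Sum>u\<in>F-{\<zero>}. g u)" if "g \<zero> = 0" for g :: "'a \<Rightarrow> real"
    using that by (simp add: sum.remove[of F \<zero>])
  have cF0: "real (card (F - {\<zero>})) = q - 1"
    using q_ge_3 by (simp add: order_def)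
  show ?thesis
  proof (cases "r = \<zero>")
    case True
    have "(\<Sum>u\<in>F-{\<zero>}. eta u * eta (r \<ominus> u)) = (\<Sum>u\<in>F-{\<zero>}. eta (\<ominus> \<one>))"
    proof (rule sum.cong)
      fix u assume u: "u \<in> F - {\<zero>}"
      then have "r \<ominus> u = \<ominus> \<one> \<otimes> u" using True by (simp add: l_minus minus_eq)
      then have "eta (r \<ominus> u) = eta (\<ominus> \<one>) * eta u" using eta_mult[of "\<ominus> \<one>" u] u by simp
      then show "eta u * eta (r \<ominus> u) = eta (\<ominus> \<one>)" using eta_nonzero[of u] u by simp
    qed simp
    then show ?thesis using True cF0 by (simp add: F0)
  next
    case False
    have "(\<Sum>u\<in>F-{\<zero>}. eta u * eta (r \<ominus> u)) = (\<Sum>u\<in>F-{\<zero>}. eta (r \<otimes> inv u \<ominus> \<one>))"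
    proof (rule sum.cong)
      fix u assume u: "u \<in> F - {\<zero>}"
      then have i: "inv u \<in> F" "u \<otimes> inv u = \<one>" using field_Units by auto
      have "u \<otimes> (r \<otimes> inv u \<ominus> \<one>) = r \<otimes> (u \<otimes> inv u) \<ominus> u"
        using u i(1) assms by (simp add: minus_eq r_distr r_minus m_lcomm)
      then have "r \<ominus> u = u \<otimes> (r \<otimes> inv u \<ominus> \<one>)" using i assms by simp
      then have "eta (r \<ominus> u) = eta u * eta (r \<otimes> inv u \<ominus> \<one>)"
        using u i assms by (simp add: eta_mult)
      then show "eta u * eta (r \<ominus> u) = eta (r \<otimes> inv u \<ominus> \<one>)"
        using eta_nonzero[of u] u by (simp flip: mult.assoc)
    qed simp
    also have "\<dots> = (\<Sum>w\<in>F-{\<ominus> \<one>}. eta w)"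
    proof (rule sum.reindex_bij_witness[where j="\<lambda>u. r \<otimes> inv u \<ominus> \<one>" and i="\<lambda>w. r \<otimes> inv (w \<oplus> \<one>)"])
      fix u assume u: "u \<in> F - {\<zero>}"
      then have d: "r \<otimes> inv u \<in> F - {\<zero>}" "r \<otimes> inv (r \<otimes> inv u) = u"
        using divide_divide[of r u] assms False by auto
      have e: "r \<otimes> inv u \<ominus> \<one> \<oplus> \<one> = r \<otimes> inv u"
        using d(1) by (simp add: minus_eq a_assoc l_neg)
      show "r \<otimes> inv (r \<otimes> inv u \<ominus> \<one> \<oplus> \<one>) = u" using d e by simp
      show "r \<otimes> inv u \<ominus> \<one> \<in> F - {\<ominus> \<one>}"
        using d e by (auto simp: l_neg)
    next
      fix w assume w: "w \<in> F - {\<ominus> \<one>}"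
      then have w1: "w \<oplus> \<one> \<in> F - {\<zero>}"
        using minus_equality[of w \<one>] by auto
      then have d: "r \<otimes> inv (w \<oplus> \<one>) \<in> F - {\<zero>}" "r \<otimes> inv (r \<otimes> inv (w \<oplus> \<one>)) = w \<oplus> \<one>"
        using divide_divide[of r "w \<oplus> \<one>"] assms False by auto
      then show "r \<otimes> inv (w \<oplus> \<one>) \<in> F - {\<zero>}" by simp
      show "r \<otimes> inv (r \<otimes> inv (w \<oplus> \<one>)) \<ominus> \<one> = w"
        using d w by (simp add: minus_eq a_assoc r_neg)
    qed simp
    also have "\<dots> = - eta (\<ominus> \<one>)"
      using sum.remove[of F "\<ominus> \<one>" eta] sum_eta by simp
    finally show ?thesis using False by (simp add: F0)
  qed
qed

text \<open>HOL-Algebra has two constants \<open>mult_of\<close>; the unqualified name in the definition of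
  \<open>primitive_elem\<close> is the one of \<open>Ring_Divisibility\<close>.\<close>

lemma group_mult_of: "group (mult_of R)"
  using field_mult_group by (simp add: Ring_Divisibility.mult_of_def Multiplicative_Group.mult_of_def)

section \<open>Primitive elements and the character of -1\<close>

text \<open>All powers of a square are squares, too few to fill the multiplicative group.\<close>

lemma primitive_nonsquare:
  assumes "primitive_elem R j"
  shows "j \<in> F" "eta j = -1"
proof -
  interpret M: group "mult_of R" by (rule group_mult_of)
  show j: "j \<in> F" using assms by (simp add: primitive_elem_def)
  show "eta j = -1"
  proof (rule ccontr)
    assume "eta j \<noteq> -1"
    then obtain s where s: "s \<in> F" "j = s \<otimes> s" using eta_nonsquare by blast
    have j0: "j \<in> carrier (mult_of R)" using assms by (simp add: primitive_elem_def)
    then have s0: "s \<noteq> \<zero>" using s by auto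
    have pow: "eta (j [^] k) = 1" for k :: nat
      by (induction k) (use j j0 eta_square[of s] s s0 in \<open>auto simp: eta_mult\<close>)
    have "carrier (mult_of R) = {j [^]\<^bsub>mult_of R\<^esub> k |k. k \<in> (UNIV :: nat set)}"
      using assms M.generate_pow_on_finite_carrier[OF _ j0] finite_carrier
      by (simp add: primitive_elem_def)
    then have "F - {\<zero>} \<subseteq> {r \<in> F. eta r = 1}" using pow by (auto simp: nat_pow_mult_of)
    then have "card (F - {\<zero>}) \<le> card {r \<in> F. eta r = 1}"
      by (intro card_mono) auto
    moreover have "real (card (F - {\<zero>})) = q - 1"
      using q_ge_3 by (simp add: order_def)
    ultimately show False using card_squares q_ge_3 by linarith
  qed
qed

text \<open>With \<open>q = 4 m + 1\<close>, the fourth power of \<open>t = j^m\<close> is 1 while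
  \<open>t^2\<close> is not 1, because \<open>j\<close> has order \<open>4 m\<close>; hence
  \<open>t^2 = -1\<close>.\<close>

lemma eta_minus_one:
  assumes "primitive_elem R j" "order R mod 4 = 1"
  shows "eta (\<ominus> \<one>) = 1"
proof -
  interpret M: group "mult_of R" by (rule group_mult_of)
  have j: "j \<in> F" "j \<in> carrier (mult_of R)" using assms by (simp_all add: primitive_elem_def)
  obtain m where m: "order R = 4 * m + 1" using assms(2) by (metis mult_div_mod_eq)
  have card: "card (carrier (mult_of R)) = order R - 1"
    by (simp add: order_def)
  have ord: "M.ord j = order R - 1"
    using assms M.generate_pow_card[OF j(2)] card by (simp add: primitive_elem_def)
  define t where "t = j [^] m"
  have t: "t \<in> F" using j by (simp add: t_def)
  have "(t \<otimes> t) \<otimes> (t \<otimes> t) = j [^] (order R - 1)"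
  proof -
    have "order R - 1 = m + m + (m + m)" using m by simp
    then show ?thesis using j by (simp add: t_def nat_pow_mult)
  qed
  also have "\<dots> = \<one>" using M.pow_eq_id[OF j(2), of "order R - 1"] ord by (simp add: nat_pow_mult_of)
  finally have "(t \<otimes> t) \<otimes> (t \<otimes> t) = \<one> \<otimes> \<one>" by simp
  then have "t \<otimes> t = \<one> \<or> t \<otimes> t = \<ominus> \<one>" using t square_eq_iff[of "t \<otimes> t" \<one>] by simp
  moreover have "t \<otimes> t \<noteq> \<one>"
  proof
    assume "t \<otimes> t = \<one>"
    then have "j [^]\<^bsub>mult_of R\<^esub> (2 * m) = \<one>\<^bsub>mult_of R\<^esub>"
      using j by (simp add: t_def nat_pow_mult nat_pow_mult_of mult_2)
    then have "4 * m dvd 2 * m" using M.pow_eq_id[OF j(2)] ord m by simp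
    then have "m = 0" by (auto dest: dvd_imp_le)
    then show False using m q_ge_3 by simp
  qed
  ultimately have "\<ominus> \<one> = t \<otimes> t" by simp
  then show ?thesis using eta_square[OF t] t by auto
qed

section \<open>Exact sizes of spheres\<close>

lemma sqnorm_closed: "x \<in> vecs R d \<Longrightarrow> sqnorm R d x \<in> F"
  by (auto simp: sqnorm_def vecs_def intro!: finsum_closed)

lemma finite_vecs: "finite (vecs R d)"
  by (simp add: vecs_def finite_PiE finite_carrier)

lemma card_vecs: "card (vecs R d) = order R ^ d"
  by (simp add: vecs_def card_PiE order_def)

lemma card_sphere_Suc:
  assumes "r \<in> F"
  shows "card (sphere R (Suc d) r) = (\<Sum>t\<in>F. card (sphere R d (r \<ominus> t \<otimes> t)))"
proof -
  have norm: "sqnorm R (Suc d) x = sqnorm R d x \<oplus> x (Suc d) \<otimes> x (Suc d)"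
    if "\<And>i. i \<in> {1..Suc d} \<Longrightarrow> x i \<in> F" for x
  proof -
    have "{1..Suc d} = insert (Suc d) {1..d}" by auto
    then show ?thesis using that
      by (simp add: sqnorm_def finsum_insert Pi_def numeral_2_eq_2 a_comm)
  qed
  have cong: "sqnorm R d x = sqnorm R d y" if "\<And>i. i \<in> {1..d} \<Longrightarrow> x i = y i" "y \<in> vecs R d" for x y
    unfolding sqnorm_def using that by (intro finsum_cong') (auto simp: vecs_def)
  have "bij_betw (\<lambda>x. (x (Suc d), restrict x {1..d})) (sphere R (Suc d) r)
     (SIGMA t:F. sphere R d (r \<ominus> t \<otimes> t))"
  proof (rule bij_betwI[where g = "\<lambda>(t, y). y(Suc d := t)"])
    show "(\<lambda>x. (x (Suc d), restrict x {1..d})) \<in> sphere R (Suc d) r \<rightarrow> (SIGMA t:F. sphere R d (r \<ominus> t \<otimes> t))"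
    proof
      fix x assume x: "x \<in> sphere R (Suc d) r"
      then have xF: "x i \<in> F" if "i \<in> {1..Suc d}" for i using that by (auto simp: sphere_def vecs_def)
      then have V: "restrict x {1..d} \<in> vecs R d" by (auto simp: vecs_def)
      have "r = sqnorm R d (restrict x {1..d}) \<oplus> x (Suc d) \<otimes> x (Suc d)"
        using x norm[OF xF] cong[OF _ V, of x] by (simp add: sphere_def)
      then have "sqnorm R d (restrict x {1..d}) = r \<ominus> x (Suc d) \<otimes> x (Suc d)"
        using sqnorm_closed[OF V] xF[of "Suc d"] by (simp add: minus_eq a_assoc r_neg)
      then show "(x (Suc d), restrict x {1..d}) \<in> (SIGMA t:F. sphere R d (r \<ominus> t \<otimes> t))"
        using V xF[of "Suc d"] by (simp add: sphere_def)
    qed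
    show "(\<lambda>(t, y). y(Suc d := t)) \<in> (SIGMA t:F. sphere R d (r \<ominus> t \<otimes> t)) \<rightarrow> sphere R (Suc d) r"
    proof safe
      fix t y assume t: "t \<in> F" and y: "y \<in> sphere R d (r \<ominus> t \<otimes> t)"
      then have V: "y \<in> vecs R d" by (simp add: sphere_def)
      have V': "y(Suc d := t) \<in> vecs R (Suc d)"
        using V t by (auto simp: vecs_def PiE_iff extensional_def)
      have "sqnorm R (Suc d) (y(Suc d := t)) = sqnorm R d (y(Suc d := t)) \<oplus> t \<otimes> t"
        using norm[of "y(Suc d := t)"] V' by (auto simp: vecs_def PiE_iff)
      also have "sqnorm R d (y(Suc d := t)) = r \<ominus> t \<otimes> t"
        using cong[OF _ V, of "y(Suc d := t)"] y by (simp add: sphere_def)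
      finally show "y(Suc d := t) \<in> sphere R (Suc d) r"
        using V' t assms by (simp add: sphere_def minus_eq a_assoc l_neg fun_upd_def)
    qed
    show "(\<lambda>(t, y). y(Suc d := t)) (x (Suc d), restrict x {1..d}) = x" if "x \<in> sphere R (Suc d) r" for x
    proof
      fix i
      have "i \<in> {1..Suc d} \<longleftrightarrow> i \<in> {1..d} \<or> i = Suc d" by auto
      then show "(\<lambda>(t, y). y(Suc d := t)) (x (Suc d), restrict x {1..d}) i = x i"
        using that by (auto simp: sphere_def vecs_def PiE_iff extensional_def)
    qed
    show "(\<lambda>x. (x (Suc d), restrict x {1..d})) ((\<lambda>(t, y). y(Suc d := t)) p) = p"
      if "p \<in> (SIGMA t:F. sphere R d (r \<ominus> t \<otimes> t))" for p
      using that by (auto simp: sphere_def vecs_def PiE_iff extensional_def fun_eq_iff)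
  qed
  then have "card (sphere R (Suc d) r) = card (SIGMA t:F. sphere R d (r \<ominus> t \<otimes> t))"
    by (rule bij_betw_same_card)
  also have "\<dots> = (\<Sum>t\<in>F. card (sphere R d (r \<ominus> t \<otimes> t)))"
    using finite_vecs by (intro card_SigmaI) (auto simp: sphere_def)
  finally show ?thesis .
qed

text \<open>Adding a coordinate convolves the counts with \<open>1 + eta\<close>. The error is
  alternately a multiple of \<open>eta\<close> (odd dimension) and of the mean-zero function that is
  \<open>q - 1\<close> at zero and -1 elsewhere (even dimension): a Jacobi sum carries the first
  into the second, and convolving the second with \<open>eta\<close> returns
  \<open>q eta\<close>.\<close>

lemma card_sphere:
  "(r \<in> F \<longrightarrow> real (card (sphere R (2 * n + 1) r)) = q ^ (2 * n) + (eta (\<ominus> \<one>) * q) ^ n * eta r) \<and>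
   (r \<in> F \<longrightarrow> real (card (sphere R (2 * n + 2) r)) =
      q ^ (2 * n + 1) + (eta (\<ominus> \<one>) * q) ^ n * eta (\<ominus> \<one>) * (if r = \<zero> then q - 1 else -1))"
proof -
  define e where "e = eta (\<ominus> \<one>)"
  have step: "real (card (sphere R (Suc d) r)) = (\<Sum>u\<in>F. (1 + eta u) * real (card (sphere R d (r \<ominus> u))))"
    if "r \<in> F" for r d
    using card_sphere_Suc[OF that, of d] sum_over_squares[of "\<lambda>u. real (card (sphere R d (r \<ominus> u)))"]
    by simp
  have odd_even: "real (card (sphere R (Suc d) r)) = a * q + b * e * (if r = \<zero> then q - 1 else -1)"
    if r: "r \<in> F" and h: "\<And>r. r \<in> F \<Longrightarrow> real (card (sphere R d r)) = a + b * eta r" for r d a b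
  proof -
    have "real (card (sphere R (Suc d) r)) = (\<Sum>u\<in>F. (1 + eta u) * (a + b * eta (r \<ominus> u)))"
      unfolding step[OF r] using r by (intro sum.cong) (simp_all add: h)
    also have "\<dots> = a * q + a * (\<Sum>u\<in>F. eta u) + b * (\<Sum>u\<in>F. eta (r \<ominus> u))
        + b * (\<Sum>u\<in>F. eta u * eta (r \<ominus> u))"
      by (simp add: algebra_simps sum.distrib sum_distrib_left order_def)
    finally show ?thesis using jacobi_sum[OF r] sum_shift[OF r, of eta] sum_eta by (simp add: e_def)
  qed
  have even_odd: "real (card (sphere R (Suc d) r)) = a * q + b * q * eta r"
    if r: "r \<in> F" and h: "\<And>r. r \<in> F \<Longrightarrow> real (card (sphere R d r)) = a + b * (if r = \<zero> then q - 1 else -1)" for r d a b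
  proof -
    \<comment> \<open>The error function is \<open>q\<close> times the indicator of zero minus 1, so
      beside the mean only the term \<open>u = r\<close> survives.\<close>
    have "real (card (sphere R (Suc d) r)) = (\<Sum>u\<in>F. (1 + eta u) * ((a - b) + b * q * (if r = u then 1 else 0)))"
      unfolding step[OF r] using r by (intro sum.cong) (auto simp: h algebra_simps)
    also have "\<dots> = (\<Sum>u\<in>F. (a - b) * (1 + eta u) + b * q * ((1 + eta u) * (if r = u then 1 else 0)))"
      by (intro sum.cong) (simp_all add: algebra_simps)
    also have "\<dots> = (a - b) * (\<Sum>u\<in>F. 1 + eta u) + b * q * (\<Sum>u\<in>F. (1 + eta u) * (if r = u then 1 else 0))"
      by (subst sum.distrib) (simp only: sum_distrib_left)
    also have "(\<Sum>u\<in>F. 1 + eta u) = q" by (simp add: sum.distrib sum_eta order_def)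
    also have "(\<Sum>u\<in>F. (1 + eta u) * (if r = u then 1 else 0)) = (\<Sum>u\<in>F. if r = u then 1 + eta u else 0)"
      by (intro sum.cong) auto
    also have "\<dots> = 1 + eta r"
      using r by simp
    finally show ?thesis by (simp add: algebra_simps)
  qed
  have base: "real (card (sphere R (Suc 0) r)) = 1 + 1 * eta r" if "r \<in> F" for r
  proof -
    \<comment> \<open>In dimension 0 the only vector is the empty function, of norm zero.\<close>
    have s0: "card (sphere R 0 u) = (if u = \<zero> then 1 else 0)" for u
      by (auto simp: sphere_def vecs_def sqnorm_def)
    have "real (card (sphere R (Suc 0) r)) = (\<Sum>u\<in>F. (1 + eta u) * (if r = u then 1 else 0))"
      unfolding step[OF that] using that by (intro sum.cong) (auto simp: s0)
    also have "\<dots> = (\<Sum>u\<in>F. if r = u then 1 + eta u else 0)" by (intro sum.cong) auto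
    finally show ?thesis using that by simp
  qed
  have "\<forall>r\<in>F. real (card (sphere R (2 * n + 1) r)) = q ^ (2 * n) + (e * q) ^ n * eta r"
  proof (induction n)
    case 0
    then show ?case using base by simp
  next
    case (Suc n)
    have ev: "real (card (sphere R (Suc (2 * n + 1)) r)) =
       q ^ (2 * n) * q + (e * q) ^ n * e * (if r = \<zero> then q - 1 else -1)" if "r \<in> F" for r
      using odd_even[OF that] Suc by blast
    show ?case
    proof
      fix r assume "r \<in> F"
      from even_odd[OF this ev]
      show "real (card (sphere R (2 * Suc n + 1) r)) = q ^ (2 * Suc n) + (e * q) ^ Suc n * eta r"
        by (simp add: mult_ac)
    qed
  qed
  then show ?thesis using odd_even[of r "2 * n + 1" "q ^ (2 * n)" "(e * q) ^ n"] by (simp add: e_def mult_ac)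
qed

section \<open>Character sums of quadratic polynomials\<close>

text \<open>Substituting \<open>r = u^2\<close> with weight \<open>1 + eta r\<close> leaves the sum
  of \<open>eta\<close> over a translate, which is 0, and a Jacobi sum after a change of
  sign.\<close>

lemma sum_eta_shifted_square:
  assumes "D \<in> F" "D \<noteq> \<zero>"
  shows "(\<Sum>u\<in>F. eta (u \<otimes> u \<oplus> D)) = -1"
proof -
  have e1: "eta (\<ominus> \<one>) * eta (\<ominus> \<one>) = 1" by (rule eta_nonzero) auto
  have "(\<Sum>u\<in>F. eta (u \<otimes> u \<oplus> D)) = (\<Sum>r\<in>F. eta (r \<oplus> D)) + (\<Sum>r\<in>F. eta r * eta (r \<oplus> D))"
    by (subst sum_over_squares) (simp add: distrib_right sum.distrib)
  also have "(\<Sum>r\<in>F. eta (r \<oplus> D)) = (\<Sum>r\<in>F. eta r)"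
    by (rule sum.reindex_bij_witness[where j="\<lambda>r. r \<oplus> D" and i="\<lambda>r. r \<ominus> D"])
      (use assms in \<open>simp_all add: minus_eq a_assoc r_neg l_neg\<close>)
  also have "(\<Sum>r\<in>F. eta r * eta (r \<oplus> D)) = (\<Sum>u\<in>F. eta (\<ominus> u) * eta (D \<ominus> u))"
    by (rule sum.reindex_bij_witness[where i="\<lambda>r. \<ominus> r" and j="\<lambda>r. \<ominus> r"])
      (use assms in \<open>simp_all add: minus_eq a_comm\<close>)
  also have "\<dots> = (\<Sum>u\<in>F. eta (\<ominus> \<one>) * (eta u * eta (D \<ominus> u)))"
  proof (rule sum.cong)
    fix u assume u: "u \<in> F"
    then have "\<ominus> u = \<ominus> \<one> \<otimes> u" by (simp add: l_minus)
    then show "eta (\<ominus> u) * eta (D \<ominus> u) = eta (\<ominus> \<one>) * (eta u * eta (D \<ominus> u))"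
      using eta_mult[of "\<ominus> \<one>" u] u by simp
  qed simp
  also have "\<dots> = -1"
    using assms jacobi_sum[of D] e1 by (simp flip: sum_distrib_left)
  finally show ?thesis using sum_eta by simp
qed

text \<open>Completing the square. If the discriminant vanishes, \<open>a f(b)\<close> is the square
  of \<open>a + b c\<close>, and since \<open>a\<close> is a nonsquare every nonzero value of
  \<open>f\<close> contributes -1. Otherwise \<open>f\<close> is linear with sum 0, or
  \<open>n f(b)\<close> is a shifted square and the sum is 1 or -1. That the large sum is negative
  is what a nonsquare radius buys.\<close>

lemma sum_eta_quadratic:
  assumes F: "a \<in> F" "c \<in> F" "n \<in> F" and a: "eta a = -1"
  defines "f \<equiv> \<lambda>b. a \<oplus> b \<otimes> (c \<oplus> c) \<oplus> b \<otimes> b \<otimes> n"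
  shows "(\<Sum>b\<in>F. eta (f b)) \<le> 1"
    and "c \<otimes> c = a \<otimes> n \<Longrightarrow> (\<Sum>b\<in>F. eta (f b)) \<le> 1 - q"
proof -
  have a0: "a \<noteq> \<zero>" using a by auto
  have fF: "f b \<in> F" if "b \<in> F" for b using F that by (simp add: f_def)
  have square: "(\<Sum>b\<in>F. eta (f b)) \<le> 1 - q" if D: "c \<otimes> c = a \<otimes> n"
  proof -
    have af: "eta (f b) = - eta ((a \<oplus> b \<otimes> c) \<otimes> (a \<oplus> b \<otimes> c))" if b: "b \<in> F" for b
    proof -
      have "(a \<oplus> b \<otimes> c) \<otimes> (a \<oplus> b \<otimes> c) = a \<otimes> a \<oplus> a \<otimes> (b \<otimes> (c \<oplus> c)) \<oplus> b \<otimes> b \<otimes> (c \<otimes> c)"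
        using F b by (simp add: l_distr r_distr a_ac m_ac)
      also have "\<dots> = a \<otimes> f b"
        unfolding D f_def using F b by (simp add: l_distr r_distr a_ac m_ac)
      finally show ?thesis using eta_mult[OF F(1) fF[OF b]] a by simp
    qed
    \<comment> \<open>A linear polynomial with nonzero constant term has at most one root, so all
      but at most one term is -1.\<close>
    have inj: "{b \<in> F. a \<oplus> b \<otimes> c = \<zero>} \<subseteq> {\<ominus> (a \<otimes> inv c)}"
    proof
      fix b assume "b \<in> {b \<in> F. a \<oplus> b \<otimes> c = \<zero>}"
      then have b: "b \<in> F" "a \<oplus> b \<otimes> c = \<zero>" by auto
      have c0: "c \<noteq> \<zero>" using b a0 F by auto
      then have i: "inv c \<in> F" "c \<otimes> inv c = \<one>" using F field_Units by auto
      have "b \<otimes> c = \<ominus> a" using minus_equality[of "b \<otimes> c" a] b F by (simp add: a_comm)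
      then have "b \<otimes> (c \<otimes> inv c) = \<ominus> (a \<otimes> inv c)"
        using b F i(1) by (simp add: l_minus flip: m_assoc)
      then show "b \<in> {\<ominus> (a \<otimes> inv c)}" using b i by simp
    qed
    have "(\<Sum>b\<in>F. eta (f b)) = (\<Sum>b\<in>F. (if a \<oplus> b \<otimes> c = \<zero> then 1 else 0) - 1)"
      using F by (intro sum.cong) (auto simp: af eta_square)
    also have "\<dots> = real (card {b \<in> F. a \<oplus> b \<otimes> c = \<zero>}) - q"
      by (simp add: sum_subtractf sum.If_cases order_def Int_def)
    also have "\<dots> \<le> 1 - q" using card_mono[OF _ inj] by simp
    finally show ?thesis .
  qed
  then show "c \<otimes> c = a \<otimes> n \<Longrightarrow> (\<Sum>b\<in>F. eta (f b)) \<le> 1 - q" .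
  show "(\<Sum>b\<in>F. eta (f b)) \<le> 1"
  proof (cases "c \<otimes> c = a \<otimes> n")
    case True
    then show ?thesis using square q_ge_3 by linarith
  next
    case False
    define D where "D = a \<otimes> n \<ominus> c \<otimes> c"
    have D: "D \<in> F" "D \<noteq> \<zero>" using False F by (auto simp: D_def)
    show ?thesis
    proof (cases "n = \<zero>")
      case True
      have c0: "c \<oplus> c \<noteq> \<zero>" using False True F double_eq_zero by auto
      then have i: "inv (c \<oplus> c) \<in> F" "(c \<oplus> c) \<otimes> inv (c \<oplus> c) = \<one>" "inv (c \<oplus> c) \<otimes> (c \<oplus> c) = \<one>"
        using F field_Units by auto
      have "(\<Sum>b\<in>F. eta (f b)) = (\<Sum>u\<in>F. eta u)"
      proof (rule sum.reindex_bij_witness[where j="f" and i="\<lambda>u. (u \<ominus> a) \<otimes> inv (c \<oplus> c)"])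
        fix b assume b: "b \<in> F"
        have f: "f b = b \<otimes> (c \<oplus> c) \<oplus> a" using b F True by (simp add: f_def a_comm)
        then have "f b \<ominus> a = b \<otimes> (c \<oplus> c)" using b F by (simp add: minus_eq a_assoc r_neg)
        then show "(f b \<ominus> a) \<otimes> inv (c \<oplus> c) = b" using b F i by (simp add: m_assoc)
      next
        fix u assume u: "u \<in> F"
        have "(u \<ominus> a) \<otimes> inv (c \<oplus> c) \<otimes> (c \<oplus> c) = u \<ominus> a" using u F i by (simp add: m_assoc)
        then show "f ((u \<ominus> a) \<otimes> inv (c \<oplus> c)) = u"
          using u F i(1) True a_comm[of a "u \<ominus> a"] by (simp add: f_def minus_eq a_assoc l_neg)
        show "(u \<ominus> a) \<otimes> inv (c \<oplus> c) \<in> F" using u F i by simp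
      qed (simp_all add: fF)
      then show ?thesis using sum_eta by simp
    next
      case n0: False
      then have i: "inv n \<in> F" "n \<otimes> inv n = \<one>" "inv n \<otimes> n = \<one>" using F field_Units by auto
      have "eta n * eta (f b) = eta ((n \<otimes> b \<oplus> c) \<otimes> (n \<otimes> b \<oplus> c) \<oplus> D)" if b: "b \<in> F" for b
      proof -
        have "(n \<otimes> b \<oplus> c) \<otimes> (n \<otimes> b \<oplus> c) \<oplus> D
            = n \<otimes> f b \<oplus> (c \<otimes> c \<oplus> \<ominus> (c \<otimes> c))"
          using F b by (simp add: D_def f_def minus_eq l_distr r_distr a_ac m_ac)
        then show ?thesis using eta_mult[OF F(3) fF[OF b]] F b fF[OF b] by (simp add: r_neg)
      qed
      then have "eta n * (\<Sum>b\<in>F. eta (f b)) = (\<Sum>b\<in>F. eta ((n \<otimes> b \<oplus> c) \<otimes> (n \<otimes> b \<oplus> c) \<oplus> D))"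
        by (simp add: sum_distrib_left)
      also have "\<dots> = (\<Sum>u\<in>F. eta (u \<otimes> u \<oplus> D))"
      proof (rule sum.reindex_bij_witness[where j="\<lambda>b. n \<otimes> b \<oplus> c" and i="\<lambda>u. inv n \<otimes> (u \<ominus> c)"])
        fix b assume b: "b \<in> F"
        have "n \<otimes> b \<oplus> c \<ominus> c = n \<otimes> b" using b F by (simp add: minus_eq a_assoc r_neg)
        then show "inv n \<otimes> (n \<otimes> b \<oplus> c \<ominus> c) = b" using b F i by (simp flip: m_assoc)
      next
        fix u assume u: "u \<in> F"
        have "n \<otimes> (inv n \<otimes> (u \<ominus> c)) = u \<ominus> c" using u F i by (simp flip: m_assoc)
        then show "n \<otimes> (inv n \<otimes> (u \<ominus> c)) \<oplus> c = u" using u F by (simp add: minus_eq a_assoc l_neg)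
      qed (use F i in simp_all)
      finally have e: "eta n * (\<Sum>b\<in>F. eta (f b)) = -1" using sum_eta_shifted_square[OF D] by simp
      then show ?thesis using eta_cases[of n] n0 by auto
    qed
  qed
qed

end

section \<open>Vectors and hyperplanes\<close>

locale finite_field_vectors = odd_finite_field R for R :: "'a ring" (structure) +
  fixes d :: nat
begin

abbreviation V where "V \<equiv> vecs R d"
abbreviation nrm where "nrm \<equiv> sqnorm R d"

text \<open>Kept as a constant so that index membership stays a single atom for rewriting.\<close>

definition ind :: "nat set" where "ind = {1..d}"

lemma finite_ind [simp]: "finite ind" by (simp add: ind_def)

lemma V_eq: "V = (\<Pi>\<^sub>E i\<in>ind. F)" by (simp add: vecs_def ind_def)

definition vadd :: "(nat \<Rightarrow> 'a) \<Rightarrow> (nat \<Rightarrow> 'a) \<Rightarrow> nat \<Rightarrow> 'a" where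
  "vadd x y = (\<lambda>i\<in>ind. x i \<oplus> y i)"
definition vsub :: "(nat \<Rightarrow> 'a) \<Rightarrow> (nat \<Rightarrow> 'a) \<Rightarrow> nat \<Rightarrow> 'a" where
  "vsub x y = (\<lambda>i\<in>ind. x i \<ominus> y i)"
definition vscale :: "'a \<Rightarrow> (nat \<Rightarrow> 'a) \<Rightarrow> nat \<Rightarrow> 'a" where
  "vscale c x = (\<lambda>i\<in>ind. c \<otimes> x i)"
definition vzero :: "nat \<Rightarrow> 'a" where
  "vzero = (\<lambda>i\<in>ind. \<zero>)"
definition dot :: "(nat \<Rightarrow> 'a) \<Rightarrow> (nat \<Rightarrow> 'a) \<Rightarrow> 'a" where
  "dot x y = (\<Oplus>i\<in>ind. x i \<otimes> y i)"

lemma nth_closed [simp]: "x \<in> V \<Longrightarrow> i \<in> ind \<Longrightarrow> x i \<in> F"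
  by (auto simp: V_eq)

lemma vec_eqI: "x \<in> V \<Longrightarrow> y \<in> V \<Longrightarrow> (\<And>i. i \<in> ind \<Longrightarrow> x i = y i) \<Longrightarrow> x = y"
  unfolding V_eq by (rule PiE_ext)

lemma restrict_closed: "(\<And>i. i \<in> ind \<Longrightarrow> f i \<in> F) \<Longrightarrow> (\<lambda>i\<in>ind. f i) \<in> V"
  by (auto simp: V_eq)

lemma vec_closed [simp]:
  "x \<in> V \<Longrightarrow> y \<in> V \<Longrightarrow> vadd x y \<in> V"
  "x \<in> V \<Longrightarrow> y \<in> V \<Longrightarrow> vsub x y \<in> V"
  "c \<in> F \<Longrightarrow> x \<in> V \<Longrightarrow> vscale c x \<in> V"
  "vzero \<in> V"
  unfolding vadd_def vsub_def vscale_def vzero_def by (auto intro!: restrict_closed)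

lemma vec_nth [simp]:
  assumes "i \<in> ind"
  shows "vadd x y i = x i \<oplus> y i" "vsub x y i = x i \<ominus> y i" "vscale c x i = c \<otimes> x i" "vzero i = \<zero>"
  using assms by (simp_all add: vadd_def vsub_def vscale_def vzero_def)

lemma finite_V [simp]: "finite V"
  by (rule finite_vecs)

lemma card_V: "real (card V) = q ^ d"
  by (simp add: card_vecs)

lemma dot_closed [simp]: "x \<in> V \<Longrightarrow> y \<in> V \<Longrightarrow> dot x y \<in> F"
  unfolding dot_def by (rule finsum_closed) (simp add: Pi_def)

lemma dot_comm: "x \<in> V \<Longrightarrow> y \<in> V \<Longrightarrow> dot x y = dot y x"
  unfolding dot_def by (rule finsum_cong') (simp_all add: Pi_def m_comm)

lemma dot_vadd_right: 
  assumes "x \<in> V" "y \<in> V" "z \<in> V" shows "dot x (vadd y z) = dot x y \<oplus> dot x z"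
proof -
  have "dot x (vadd y z) = (\<Oplus>i\<in>ind. x i \<otimes> y i \<oplus> x i \<otimes> z i)"
    unfolding dot_def using assms
    by (intro finsum_cong') (simp_all add: Pi_def r_distr)
  then show ?thesis unfolding dot_def using assms
    by (simp add: finsum_addf Pi_def)
qed

lemma dot_vscale_right:
  assumes "c \<in> F" "x \<in> V" "y \<in> V" shows "dot x (vscale c y) = c \<otimes> dot x y"
proof -
  have "dot x (vscale c y) = (\<Oplus>i\<in>ind. c \<otimes> (x i \<otimes> y i))"
    unfolding dot_def using assms
    by (intro finsum_cong') (simp_all add: Pi_def m_lcomm)
  then show ?thesis unfolding dot_def using assms
    by (simp add: finsum_rdistr Pi_def)
qed

lemma vsub_eq: "x \<in> V \<Longrightarrow> y \<in> V \<Longrightarrow> vsub x y = vadd x (vscale (\<ominus> \<one>) y)"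
  by (rule vec_eqI) (simp_all add: minus_eq l_minus)

lemma dot_vsub_right: "x \<in> V \<Longrightarrow> y \<in> V \<Longrightarrow> z \<in> V \<Longrightarrow> dot x (vsub y z) = dot x y \<ominus> dot x z"
  by (simp add: vsub_eq dot_vadd_right dot_vscale_right l_minus minus_eq)

lemma dot_vzero_right [simp]: "x \<in> V \<Longrightarrow> dot x vzero = \<zero>"
  using dot_vscale_right[of \<zero> x x] vec_eqI[of vzero "vscale \<zero> x"] by (simp)

lemma dot_left:
  "x \<in> V \<Longrightarrow> y \<in> V \<Longrightarrow> z \<in> V \<Longrightarrow> dot (vadd x y) z = dot x z \<oplus> dot y z"
  "x \<in> V \<Longrightarrow> y \<in> V \<Longrightarrow> z \<in> V \<Longrightarrow> dot (vsub x y) z = dot x z \<ominus> dot y z"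
  "c \<in> F \<Longrightarrow> x \<in> V \<Longrightarrow> y \<in> V \<Longrightarrow> dot (vscale c x) y = c \<otimes> dot x y"
  "x \<in> V \<Longrightarrow> dot vzero x = \<zero>"
  by (metis dot_comm dot_vadd_right vec_closed(1), metis dot_comm dot_vsub_right vec_closed(2),
    metis dot_comm dot_vscale_right vec_closed(3), metis dot_comm dot_vzero_right vec_closed(4))

lemmas dot_simps = dot_left dot_vadd_right dot_vsub_right dot_vscale_right

lemma nrm_dot: "x \<in> V \<Longrightarrow> nrm x = dot x x"
  unfolding dot_def sqnorm_def ind_def[symmetric]
  by (rule finsum_cong') (simp_all add: Pi_def numeral_2_eq_2)

lemma nrm_closed [simp]: "x \<in> V \<Longrightarrow> nrm x \<in> F"
  by (rule sqnorm_closed)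

lemma vsub_vadd: "x \<in> V \<Longrightarrow> y \<in> V \<Longrightarrow> vsub (vadd x y) y = x"
  by (rule vec_eqI) (simp_all add: minus_eq a_assoc r_neg)

lemma vadd_vsub: "x \<in> V \<Longrightarrow> y \<in> V \<Longrightarrow> vadd (vsub x y) y = x"
  by (rule vec_eqI) (simp_all add: minus_eq a_assoc l_neg)

lemma vsub_self: "x \<in> V \<Longrightarrow> vsub x x = vzero"
  by (rule vec_eqI) (simp_all add: minus_eq r_neg)

lemma vsub_eq_zero_iff: "x \<in> V \<Longrightarrow> y \<in> V \<Longrightarrow> vsub x y = vzero \<longleftrightarrow> x = y"
proof
  assume V: "x \<in> V" "y \<in> V" and "vsub x y = vzero"
  then have "vadd vzero y = x" using vadd_vsub by metis
  moreover have "vadd vzero y = y" using V by (intro vec_eqI) (simp_all)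
  ultimately show "x = y" by simp
qed (simp add: vsub_self)

lemma dot_nondegenerate:
  assumes "v \<in> V" "v \<noteq> vzero"
  shows "\<exists>w\<in>V. dot v w = \<one>"
proof -
  obtain i where i: "i \<in> ind" "v i \<noteq> \<zero>"
    using vec_eqI[of v vzero] assms by (auto)
  then have inv: "inv (v i) \<in> F" "v i \<otimes> inv (v i) = \<one>"
    using assms field_Units nth_closed[OF assms(1) i(1)] by auto
  define w where "w = (\<lambda>k\<in>ind. if i = k then inv (v i) else \<zero>)"
  have w: "w \<in> V" unfolding w_def using inv by (intro restrict_closed) auto
  have "dot v w = (\<Oplus>k\<in>ind. if i = k then v i \<otimes> inv (v i) else \<zero>)"
    unfolding dot_def using assms inv i
    by (intro finsum_cong') (auto simp: Pi_def w_def)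
  also have "\<dots> = \<one>" unfolding inv(2) using finsum_singleton[OF i(1), of "\<lambda>_. \<one>"] by simp
  finally show ?thesis using w by blast
qed

section \<open>Points on one and on two hyperplanes\<close>

text \<open>Translation along a \<open>w\<close> with \<open>dot v w = \<one>\<close> moves one
  level set of \<open>dot v\<close> onto another, and the \<open>q\<close> levels partition
  \<open>V\<close>. The factor \<open>q\<close> on the left avoids the exponent
  \<open>d - 1\<close>.\<close>

lemma card_hyperplane:
  assumes "v \<in> V" "v \<noteq> vzero" "c \<in> F"
  shows "q * real (card {x \<in> V. dot v x = c}) = q ^ d"
proof -
  obtain w where w: "w \<in> V" "dot v w = \<one>" using dot_nondegenerate assms by blast
  have eq: "card {x \<in> V. dot v x = b} = card {x \<in> V. dot v x = c}" if b: "b \<in> F" for b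
  proof (rule bij_betw_same_card, rule bij_betwI[where f = "\<lambda>x. vadd x (vscale (c \<ominus> b) w)" and g = "\<lambda>x. vsub x (vscale (c \<ominus> b) w)"])
    show "(\<lambda>x. vadd x (vscale (c \<ominus> b) w)) \<in> {x \<in> V. dot v x = b} \<rightarrow> {x \<in> V. dot v x = c}"
      using assms w b a_comm[of b "c \<ominus> b"] by (auto simp: dot_simps minus_eq a_assoc l_neg)
    have "c \<ominus> (c \<ominus> b) = b" using assms b by (simp add: minus_eq minus_add r_neg flip: a_assoc)
    then show "(\<lambda>x. vsub x (vscale (c \<ominus> b) w)) \<in> {x \<in> V. dot v x = c} \<rightarrow> {x \<in> V. dot v x = b}"
      using assms w b by (auto simp: dot_simps)
  qed (use w assms b in \<open>auto simp: vsub_vadd vadd_vsub\<close>)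
  have "q ^ d = (\<Sum>x\<in>V. real (card {b \<in> F. dot v x = b}))"
  proof -
    have "{b \<in> F. dot v x = b} = {dot v x}" if "x \<in> V" for x using that assms by auto
    then show ?thesis by (simp add: card_V[symmetric])
  qed
  also have "\<dots> = (\<Sum>b\<in>F. real (card {x \<in> V. dot v x = b}))" by (rule sum_card_swap) auto
  also have "\<dots> = (\<Sum>b\<in>F. real (card {x \<in> V. dot v x = c}))" using eq by simp
  finally show ?thesis by (simp add: order_def)
qed

text \<open>The members of the pencil \<open>v + b w\<close> of hyperplanes cover every point outside
  \<open>w\<^sup>\<bottom>\<close> exactly once.\<close>

lemma card_codim_two:
  assumes V: "v \<in> V" "w \<in> V" "w \<noteq> vzero" and indep: "\<And>b. b \<in> F \<Longrightarrow> vadd v (vscale b w) \<noteq> vzero"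
  shows "q\<^sup>2 * real (card {x \<in> V. dot v x = \<zero> \<and> dot w x = \<zero>}) = q ^ d"
proof -
  let ?H = "{x \<in> V. dot w x = \<zero>}" and ?N = "{x \<in> V. dot v x = \<zero> \<and> dot w x = \<zero>}"
  have count: "real (card {b \<in> F. dot (vadd v (vscale b w)) x = \<zero>})
      = 1 - of_bool (dot w x = \<zero>) + q * of_bool (dot v x = \<zero> \<and> dot w x = \<zero>)" if x: "x \<in> V" for x
  proof (cases "dot w x = \<zero>")
    case True
    then have "{b \<in> F. dot (vadd v (vscale b w)) x = \<zero>} = (if dot v x = \<zero> then F else {})"
      using V x by (auto simp: dot_simps)
    then show ?thesis using True by (simp add: order_def)
  next
    case False
    then have i: "inv (dot w x) \<in> F" "dot w x \<otimes> inv (dot w x) = \<one>" "inv (dot w x) \<otimes> dot w x = \<one>"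
      using V x field_Units by auto
    have "{b \<in> F. dot (vadd v (vscale b w)) x = \<zero>} = {\<ominus> (dot v x) \<otimes> inv (dot w x)}"
    proof safe
      fix b assume b: "b \<in> F" "dot (vadd v (vscale b w)) x = \<zero>"
      then have "\<ominus> (dot v x) = b \<otimes> dot w x"
        using minus_equality[of "b \<otimes> dot w x" "dot v x"] V x by (simp add: dot_simps a_comm)
      then show "b = \<ominus> (dot v x) \<otimes> inv (dot w x)" using b V x i by (simp add: m_assoc)
    qed (use V x i in \<open>simp_all add: dot_simps m_assoc r_neg\<close>)
    then show ?thesis using False by simp
  qed
  have "q * real (card {x \<in> V. dot (vadd v (vscale b w)) x = \<zero>}) = q ^ d" if "b \<in> F" for b
    using card_hyperplane[of "vadd v (vscale b w)" \<zero>] V indep that by simp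
  then have "(\<Sum>b\<in>F. q * real (card {x \<in> V. dot (vadd v (vscale b w)) x = \<zero>})) = q * q ^ d"
    by (simp add: order_def)
  moreover have "(\<Sum>b\<in>F. real (card {x \<in> V. dot (vadd v (vscale b w)) x = \<zero>}))
      = (\<Sum>x\<in>V. 1 - of_bool (dot w x = \<zero>) + q * of_bool (dot v x = \<zero> \<and> dot w x = \<zero>))"
    by (subst sum_card_swap) (simp_all add: count)
  moreover have "\<dots> = q ^ d - real (card ?H) + q * real (card ?N)"
    by (simp add: sum.distrib sum_subtractf sum_of_bool_eq card_V Int_def flip: sum_distrib_left)
  ultimately have "q * (q ^ d - real (card ?H) + q * real (card ?N)) = q * q ^ d"
    by (simp flip: sum_distrib_left)
  moreover have "q * real (card ?H) = q ^ d" using card_hyperplane[of w \<zero>] V by simp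
  ultimately show ?thesis by (simp add: algebra_simps power2_eq_square)
qed

end

section \<open>Hyperplane sections of elliptic spheres\<close>

text \<open>Writing \<open>d = 2 m + 3\<close> expresses every size through \<open>Q = q^m\<close>
  without subtraction in exponents; \<open>q Q\<close> is the \<open>q^((d-1)/2)\<close> of the
  theorem. \<open>elliptic\<close> makes the error in the sphere count exactly
  \<open>q Q eta r\<close>, negative for the nonsquare \<open>j\<close>.\<close>

locale elliptic_sphere = finite_field_vectors R d for R :: "'a ring" (structure) and d :: nat +
  fixes m :: nat and j :: 'a
  assumes d_eq: "d = 2 * m + 3" and j_closed [simp]: "j \<in> F" and eta_j: "eta j = -1"
    and elliptic: "eta (\<ominus> \<one>) ^ (m + 1) = 1"
begin

abbreviation S where "S \<equiv> sphere R d j"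
abbreviation Q :: real where "Q \<equiv> q ^ m"

lemma minus_same [simp]: "x \<in> F \<Longrightarrow> x \<ominus> x = \<zero>"
  by (simp add: minus_eq r_neg)

lemma Q_ge_1: "Q \<ge> 1"
  using q_ge_3 by simp

lemma finite_S [simp]: "finite S"
  by (simp add: sphere_def)

lemma S_D: "x \<in> S \<Longrightarrow> x \<in> V" "x \<in> S \<Longrightarrow> nrm x = j" "x \<in> S \<Longrightarrow> dot x x = j"
  by (auto simp: sphere_def nrm_dot)

lemma j_nonzero: "j \<noteq> \<zero>"
  using eta_j by auto

lemma q_d: "q ^ d = q ^ 3 * Q\<^sup>2"
proof -
  have d: "d = m + m + 3" by (simp add: d_eq)
  show ?thesis unfolding d by (simp only: power_add power2_eq_square mult_ac)
qed

lemma card_sphere_elliptic: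
  assumes "r \<in> F" shows "real (card (sphere R d r)) = q\<^sup>2 * Q\<^sup>2 + q * Q * eta r"
proof -
  have d: "d = 2 * (m + 1) + 1" by (simp add: d_eq)
  have "real (card (sphere R d r)) = q ^ (2 * (m + 1)) + (eta (\<ominus> \<one>) * q) ^ (m + 1) * eta r"
    unfolding d using card_sphere[of r "m + 1"] assms by blast
  also have "(eta (\<ominus> \<one>) * q) ^ (m + 1) = q * Q"
    unfolding power_mult_distrib elliptic by simp
  also have "2 * (m + 1) = (m + 1) + (m + 1)" by simp
  also have "q ^ ((m + 1) + (m + 1)) = (q * Q)\<^sup>2" by (simp only: power_add power2_eq_square power_one_right mult_ac)
  finally show ?thesis by (simp add: power_mult_distrib)
qed

lemma card_S: "real (card S) = q\<^sup>2 * Q\<^sup>2 - q * Q"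
  by (simp add: card_sphere_elliptic eta_j)

lemma nrm_translate:
  assumes "x \<in> V" "v \<in> V" "b \<in> F"
  shows "nrm (vadd x (vscale b v)) = nrm x \<oplus> b \<otimes> (dot v x \<oplus> dot v x) \<oplus> b \<otimes> b \<otimes> nrm v"
  using assms dot_comm[of x v] by (simp add: nrm_dot dot_simps l_distr r_distr a_ac m_ac)

lemma card_translate:
  assumes "w \<in> V"
  shows "card {x \<in> V. nrm (vadd x w) = r} = card (sphere R d r)"
  by (rule bij_betw_same_card, rule bij_betwI[where f = "\<lambda>x. vadd x w" and g = "\<lambda>x. vsub x w"])
    (use assms in \<open>auto simp: sphere_def vsub_vadd vadd_vsub\<close>)

text \<open>The spheres of squared radius \<open>j + 2bc + b\<^sup>2\<parallel>v\<parallel>\<close> about \<open>-bv\<close> all pass through the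
  section of \<open>S\<close> by the hyperplane \<open>v \<cdot> x = c\<close>, and every point off the hyperplane lies on exactly
  one of them.\<close>

lemma card_section:
  assumes v: "v \<in> V" "v \<noteq> vzero" and c: "c \<in> F"
  shows "real (card {x \<in> S. dot v x = c}) =
    q * Q\<^sup>2 + Q * (\<Sum>b\<in>F. eta (j \<oplus> b \<otimes> (c \<oplus> c) \<oplus> b \<otimes> b \<otimes> nrm v))"
proof -
  define r where "r b = j \<oplus> b \<otimes> (c \<oplus> c) \<oplus> b \<otimes> b \<otimes> nrm v" for b
  let ?P = "\<lambda>x b. nrm (vadd x (vscale b v)) = r b"
  have r: "r b \<in> F" if "b \<in> F" for b using that v c by (simp add: r_def)
  have count: "real (card {b \<in> F. ?P x b}) = 1 - of_bool (dot v x = c) + q * of_bool (nrm x = j \<and> dot v x = c)"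
    if x: "x \<in> V" for x
  proof -
    \<comment> \<open>\<open>e\<close> is twice \<open>c - v x\<close>: the quadratic terms in
      \<open>b\<close> agree on both sides, so the sphere condition becomes linear in
      \<open>b\<close> with slope \<open>e\<close>.\<close>
    define e where "e = (c \<ominus> dot v x) \<oplus> (c \<ominus> dot v x)"
    have e: "e \<in> F" "e = \<zero> \<longleftrightarrow> dot v x = c"
      using x v c double_eq_zero[of "c \<ominus> dot v x"] by (auto simp: e_def)
    have "?P x b \<longleftrightarrow> nrm x = j \<oplus> b \<otimes> e" if b: "b \<in> F" for b
    proof -
      have 1: "nrm (vadd x (vscale b v)) = nrm x \<oplus> (b \<otimes> (dot v x \<oplus> dot v x) \<oplus> b \<otimes> b \<otimes> nrm v)"
        using x v b by (simp add: nrm_translate a_assoc)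
      have "(j \<oplus> b \<otimes> e) \<oplus> (b \<otimes> (dot v x \<oplus> dot v x) \<oplus> b \<otimes> b \<otimes> nrm v) =
         r b \<oplus> ((b \<otimes> dot v x \<ominus> b \<otimes> dot v x) \<oplus> (b \<otimes> dot v x \<ominus> b \<otimes> dot v x))"
        using x v b c unfolding e_def r_def minus_eq
        by (simp add: r_distr l_distr a_ac r_minus)
      also have "\<dots> = r b" using x v b r[OF b] by (simp add: minus_eq r_neg)
      finally have 2: "r b = (j \<oplus> b \<otimes> e) \<oplus> (b \<otimes> (dot v x \<oplus> dot v x) \<oplus> b \<otimes> b \<otimes> nrm v)" by simp
      show ?thesis unfolding 1 2 using x v b e by (intro add.right_cancel) auto
    qed
    then have eq: "{b \<in> F. ?P x b} = {b \<in> F. nrm x = j \<oplus> b \<otimes> e}" by auto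
    show ?thesis
    proof (cases "e = \<zero>")
      case True
      then have "{b \<in> F. ?P x b} = (if nrm x = j then F else {})" unfolding eq using x by auto
      then show ?thesis using e True by (simp add: order_def)
    next
      case False
      then have i: "inv e \<in> F" "e \<otimes> inv e = \<one>" "inv e \<otimes> e = \<one>" using e field_Units by auto
      have "{b \<in> F. ?P x b} = {(nrm x \<ominus> j) \<otimes> inv e}" unfolding eq
      proof safe
        fix b assume b: "b \<in> F" "nrm x = j \<oplus> b \<otimes> e"
        have "nrm x \<ominus> j = b \<otimes> e" unfolding b(2) using b(1) e a_comm[of j "b \<otimes> e"] by (simp add: minus_eq a_assoc r_neg)
        then show "b = (nrm x \<ominus> j) \<otimes> inv e" using b e i by (simp add: m_assoc)
      next
        have "(nrm x \<ominus> j) \<otimes> inv e \<otimes> e = nrm x \<ominus> j" using x e i by (simp add: m_assoc)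
        then show "nrm x = j \<oplus> (nrm x \<ominus> j) \<otimes> inv e \<otimes> e"
          using x a_comm[of j "nrm x \<ominus> j"] by (simp add: minus_eq a_assoc l_neg)
      qed (use x i in simp_all)
      then show ?thesis using e False by simp
    qed
  qed
  have "(\<Sum>b\<in>F. real (card {x \<in> V. ?P x b})) = (\<Sum>b\<in>F. q\<^sup>2 * Q\<^sup>2 + q * Q * eta (r b))"
    using v r by (intro sum.cong) (simp_all add: card_translate card_sphere_elliptic)
  also have "\<dots> = q * (q\<^sup>2 * Q\<^sup>2) + q * Q * (\<Sum>b\<in>F. eta (r b))"
    by (simp add: sum.distrib sum_distrib_left order_def)
  finally have 1: "(\<Sum>b\<in>F. real (card {x \<in> V. ?P x b})) = \<dots>" .
  have "(\<Sum>b\<in>F. real (card {x \<in> V. ?P x b})) =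
     (\<Sum>x\<in>V. 1 - of_bool (dot v x = c) + q * of_bool (nrm x = j \<and> dot v x = c))"
    by (subst sum_card_swap) (simp_all add: count)
  also have "\<dots> = q ^ d - real (card {x \<in> V. dot v x = c}) + q * real (card {x \<in> S. dot v x = c})"
    by (simp add: sum.distrib sum_subtractf sum_of_bool_eq card_V Int_def sphere_def conj_assoc flip: sum_distrib_left)
  finally have 2: "q * real (card {x \<in> S. dot v x = c}) =
      q * (q\<^sup>2 * Q\<^sup>2) + q * Q * (\<Sum>b\<in>F. eta (r b)) - q ^ d + real (card {x \<in> V. dot v x = c})"
    using 1 by simp
  have 3: "real (card {x \<in> V. dot v x = c}) = q\<^sup>2 * Q\<^sup>2"
    using card_hyperplane[OF v c] q_ge_3 unfolding q_d by (simp add: power3_eq_cube power2_eq_square)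
  have "q * real (card {x \<in> S. dot v x = c}) = q * (q * Q\<^sup>2 + Q * (\<Sum>b\<in>F. eta (r b)))"
    unfolding 2 3 q_d by (simp add: power3_eq_cube power2_eq_square algebra_simps)
  then show ?thesis using q_ge_3 unfolding r_def by simp
qed

section \<open>Sections by one and by two tangent hyperplanes\<close>

text \<open>The condition \<open>c \<otimes> c = j \<otimes> nrm v\<close> is the vanishing
  discriminant in \<open>sum_eta_quadratic\<close>: the hyperplane is tangent to \<open>S\<close>,
  possibly at infinity. The large deviation there is negative, so upper bounds cost only
  \<open>Q\<close> while the lower bound concedes \<open>q Q\<close>.\<close>

lemma
  assumes v: "v \<in> V" "v \<noteq> vzero" and c: "c \<in> F"
  shows card_section_le: "real (card {x \<in> S. dot v x = c}) \<le> q * Q\<^sup>2 + Q"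
    and card_section_ge: "real (card {x \<in> S. dot v x = c}) \<ge> q * Q\<^sup>2 - q * Q"
    and card_tangent_section_le: "c \<otimes> c = j \<otimes> nrm v \<Longrightarrow>
      real (card {x \<in> S. dot v x = c}) \<le> q * Q\<^sup>2 + Q - q * Q"
proof -
  let ?E = "\<Sum>b\<in>F. eta (j \<oplus> b \<otimes> (c \<oplus> c) \<oplus> b \<otimes> b \<otimes> nrm v)"
  have Q0: "Q \<ge> 0" using q_ge_3 by simp
  have "?E \<le> 1" using sum_eta_quadratic(1)[OF j_closed c _ eta_j] v by simp
  then have "Q * ?E \<le> Q * 1" using Q0 by (rule mult_left_mono)
  then show "real (card {x \<in> S. dot v x = c}) \<le> q * Q\<^sup>2 + Q" unfolding card_section[OF assms] by simp
  have "eta r \<ge> -1" for r using eta_cases[of r] by auto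
  then have "(\<Sum>b\<in>F. -1) \<le> ?E" by (intro sum_mono)
  then have "- q \<le> ?E" by (simp add: order_def)
  then have "Q * (- q) \<le> Q * ?E" using Q0 by (rule mult_left_mono)
  then show "real (card {x \<in> S. dot v x = c}) \<ge> q * Q\<^sup>2 - q * Q"
    unfolding card_section[OF assms] by (simp add: mult.commute)
  assume "c \<otimes> c = j \<otimes> nrm v"
  then have "?E \<le> 1 - q" using sum_eta_quadratic(2)[OF j_closed c _ eta_j] v by simp
  then have "Q * ?E \<le> Q * (1 - q)" using Q0 by (rule mult_left_mono)
  then show "real (card {x \<in> S. dot v x = c}) \<le> q * Q\<^sup>2 + Q - q * Q"
    unfolding card_section[OF assms] by (simp add: algebra_simps)
qed

lemma vzero_notin_S: "vzero \<notin> S"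
  using j_nonzero S_D(3)[of vzero] by (auto simp: dot_simps)

text \<open>The hyperplanes with normal \<open>x + b y\<close> and level \<open>j + b j\<close> form
  a pencil through the intersection of the tangent hyperplanes at \<open>x\<close> and
  \<open>y\<close>. Their sections of \<open>S\<close> add up to the size of \<open>S\<close>, minus
  the section tangent at \<open>y\<close>, plus \<open>q\<close> times the wanted count. If
  \<open>dot x y = j\<close>, every member is tangent and the bound on its section drops by
  \<open>q Q\<close>.\<close>

lemma
  assumes x: "x \<in> S" and y: "y \<in> S" and ne: "x \<noteq> y"
  shows card_double_tangent_le: "real (card {z \<in> S. dot x z = j \<and> dot y z = j}) \<le> Q\<^sup>2 + 2 * Q"
    and card_double_tangent_isotropic_le: "dot x y = j \<Longrightarrow>
      real (card {z \<in> S. dot x z = j \<and> dot y z = j}) \<le> Q\<^sup>2 + 2 * Q - q * Q"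
proof -
  let ?N = "real (card {z \<in> S. dot x z = j \<and> dot y z = j})"
  note V = S_D(1)[OF x] S_D(1)[OF y]
  have y0: "y \<noteq> vzero" using y vzero_notin_S by auto
  have "?N \<le> Q\<^sup>2 + 2 * Q \<and> (dot x y = j \<longrightarrow> ?N \<le> Q\<^sup>2 + 2 * Q - q * Q)"
  \<comment> \<open>A dependency forces \<open>b^2 = 1\<close>. Then \<open>y = x\<close>, which is
    excluded, or \<open>y = -x\<close>, and the two tangent hyperplanes are disjoint.\<close>
  proof (cases "\<exists>b\<in>F. vadd x (vscale b y) = vzero")
    case True
    then obtain b where b: "b \<in> F" "vadd x (vscale b y) = vzero" by blast
    have dx: "dot x z \<oplus> b \<otimes> dot y z = \<zero>" if "z \<in> V" for z
      using b(2) V b(1) that dot_left(1)[of x "vscale b y" z] by (simp add: dot_simps)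
    have xy: "dot x y = dot y x" using dot_comm V by blast
    have "j \<oplus> b \<otimes> dot x y = \<zero>" "dot x y \<oplus> b \<otimes> j = \<zero>"
      using dx[OF V(1)] dx[OF V(2)] S_D(3)[OF x] S_D(3)[OF y] xy by auto
    then have "dot x y = \<ominus> (b \<otimes> j)" "b \<otimes> dot x y = \<ominus> j"
      using b V minus_equality[of "dot x y" "b \<otimes> j"] minus_equality[of "b \<otimes> dot x y" j]
      by (simp_all add: a_comm)
    then have "\<ominus> j = b \<otimes> \<ominus> (b \<otimes> j)" by simp
    then have "\<ominus> j = \<ominus> (b \<otimes> b \<otimes> j)" using b by (simp add: r_minus m_assoc)
    then have "b \<otimes> b \<otimes> j = \<one> \<otimes> j" using b by (metis j_closed l_one m_closed minus_minus)
    then have "b \<otimes> b = \<one> \<otimes> \<one>" using b j_nonzero m_rcancel[of j "b \<otimes> b" \<one>] by simp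
    then consider "b = \<one>" | "b = \<ominus> \<one>" using b square_eq_iff[of b \<one>] by auto
    then show ?thesis
    proof cases
      case 1
      have "dot x z \<noteq> j \<or> dot y z \<noteq> j" if "z \<in> S" for z
        using V dx[of z] S_D(1)[OF that] 1 double_eq_zero[of j] j_nonzero by auto
      then have "{z \<in> S. dot x z = j \<and> dot y z = j} = {}" by auto
      then have "?N = 0" by (simp only: card.empty)
      moreover have "dot x y \<noteq> j"
        using dx[OF V(2)] 1 double_eq_zero[of j] j_nonzero S_D(3)[OF y] by auto
      moreover have "0 \<le> Q\<^sup>2 + 2 * Q" using Q_ge_1 by simp
      ultimately show ?thesis by linarith
    next
      case 2
      have "vsub x y = vzero" using b 2 V by (simp add: vsub_eq)
      then show ?thesis using vsub_eq_zero_iff V ne by simp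
    qed
  next
    case False
    define c where "c b = j \<oplus> b \<otimes> j" for b
    have cF: "c b \<in> F" if "b \<in> F" for b using that by (simp add: c_def)
    have nz: "vadd x (vscale b y) \<noteq> vzero" if "b \<in> F" for b using False that by blast
    let ?P = "\<lambda>z b. dot (vadd x (vscale b y)) z = c b"
    have count: "real (card {b \<in> F. ?P z b}) = 1 - of_bool (dot y z = j) + q * of_bool (dot x z = j \<and> dot y z = j)"
      if "z \<in> S" for z
    proof -
      note z = S_D(1)[OF that]
      have P: "?P z b \<longleftrightarrow> dot x z \<ominus> j = b \<otimes> (j \<ominus> dot y z)" if b: "b \<in> F" for b
      proof -
        have 1: "dot (vadd x (vscale b y)) z = (dot x z \<ominus> j) \<oplus> (j \<oplus> b \<otimes> dot y z)"
          using V z b by (simp add: dot_simps minus_eq a_assoc) (simp add: l_neg r_neg1 flip: a_assoc)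
        have 2: "c b = b \<otimes> (j \<ominus> dot y z) \<oplus> (j \<oplus> b \<otimes> dot y z)"
        proof -
          have "b \<otimes> (j \<ominus> dot y z) \<oplus> (j \<oplus> b \<otimes> dot y z) = c b \<oplus> (b \<otimes> dot y z \<ominus> b \<otimes> dot y z)"
            unfolding c_def minus_eq using V z b by (simp add: r_distr r_minus a_ac)
          then show ?thesis using V z b cF[OF b] by (simp add: minus_eq r_neg)
        qed
        show ?thesis unfolding 1 2 using V z b by (intro add.right_cancel) auto
      qed
      then have eq: "{b \<in> F. ?P z b} = {b \<in> F. dot x z \<ominus> j = b \<otimes> (j \<ominus> dot y z)}" by auto
      show ?thesis
      proof (cases "dot y z = j")
        case True
        then have "{b \<in> F. ?P z b} = (if dot x z = j then F else {})" unfolding eq using V z by auto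
        then show ?thesis using True by (simp add: order_def)
      next
        case False
        define e where "e = j \<ominus> dot y z"
        have e: "e \<in> F" "e \<noteq> \<zero>" using False V z by (auto simp: e_def)
        then have i: "inv e \<in> F" "e \<otimes> inv e = \<one>" "inv e \<otimes> e = \<one>" using field_Units by auto
        have "{b \<in> F. ?P z b} = {(dot x z \<ominus> j) \<otimes> inv e}"
          unfolding eq e_def[symmetric] using V z e i by (auto simp: m_assoc)
        then show ?thesis using False by simp
      qed
    qed
    have "(\<Sum>b\<in>F. real (card {z \<in> S. ?P z b})) =
        (\<Sum>z\<in>S. 1 - of_bool (dot y z = j) + q * of_bool (dot x z = j \<and> dot y z = j))"
      by (subst sum_card_swap) (simp_all add: count)
    also have "\<dots> = real (card S) - real (card {z \<in> S. dot y z = j}) + q * ?N"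
      by (simp add: sum.distrib sum_subtractf sum_of_bool_eq Int_def flip: sum_distrib_left)
    finally have total: "q * ?N = (\<Sum>b\<in>F. real (card {z \<in> S. ?P z b})) - (q\<^sup>2 * Q\<^sup>2 - q * Q)
        + real (card {z \<in> S. dot y z = j})"
      by (simp add: card_S)
    have ty: "real (card {z \<in> S. dot y z = j}) \<le> q * Q\<^sup>2 + Q - q * Q"
      using card_tangent_section_le[OF V(2) y0 j_closed] S_D(2)[OF y] by simp
    have qQ: "Q \<le> q * Q" using q_ge_3 Q_ge_1 by simp
    have "(\<Sum>b\<in>F. real (card {z \<in> S. ?P z b})) \<le> (\<Sum>b\<in>F. q * Q\<^sup>2 + Q)"
      using V nz cF by (intro sum_mono card_section_le) auto
    then have "q * ?N \<le> q * (Q\<^sup>2 + 2 * Q)"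
      using total ty qQ by (simp add: order_def algebra_simps power2_eq_square)
    then have N1: "?N \<le> Q\<^sup>2 + 2 * Q" using q_ge_3 by simp
    have N2: "?N \<le> Q\<^sup>2 + 2 * Q - q * Q" if xy: "dot x y = j"
    proof -
      \<comment> \<open>The normal has norm \<open>j (1 + b)^2\<close> and the level is
        \<open>j (1 + b)\<close>.\<close>
      have tangent: "c b \<otimes> c b = j \<otimes> nrm (vadd x (vscale b y))" if b: "b \<in> F" for b
      proof -
        have "nrm (vadd x (vscale b y)) = j \<oplus> b \<otimes> (j \<oplus> j) \<oplus> b \<otimes> b \<otimes> j"
          using nrm_translate[OF V b] dot_comm[OF V] xy S_D(2)[OF x] S_D(2)[OF y] by simp
        then show ?thesis using b by (simp add: c_def l_distr r_distr a_ac m_ac)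
      qed
      have "(\<Sum>b\<in>F. real (card {z \<in> S. ?P z b})) \<le> (\<Sum>b\<in>F. q * Q\<^sup>2 + Q - q * Q)"
        using V nz cF tangent by (intro sum_mono card_tangent_section_le) auto
      then have "q * ?N \<le> q * (Q\<^sup>2 + 2 * Q - q * Q)"
        using total ty qQ by (simp add: order_def algebra_simps power2_eq_square)
      then show ?thesis using q_ge_3 by simp
    qed
    show ?thesis using N1 N2 by blast
  qed
  then show "?N \<le> Q\<^sup>2 + 2 * Q" "dot x y = j \<Longrightarrow> ?N \<le> Q\<^sup>2 + 2 * Q - q * Q" by blast+
qed

text \<open>On an elliptic quadric the collinearity graph has no large positive eigenvalue. Here this
  shows up as the nonnegativity of the variance of \<open>h\<close> over the sphere.\<close>

lemma isotropic_pairs_le: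
  assumes A: "A \<subseteq> S"
  shows "q * real (card {p \<in> A \<times> A. fst p \<noteq> snd p \<and> dot (fst p) (snd p) = j})
    \<le> q * Q * real (card A) + 4 * (real (card A))\<^sup>2"
proof -
  let ?a = "real (card A)"
  let ?I = "{p \<in> A \<times> A. fst p \<noteq> snd p \<and> dot (fst p) (snd p) = j}"
  define h where "h y = real (card {x \<in> A. dot x y = j})" for y
  have fA [simp]: "finite A" using A finite_S finite_subset by blast
  have tangent: "real (card {y \<in> S. dot x y = j}) \<le> q * Q\<^sup>2 + Q - q * Q"
      "real (card {y \<in> S. dot x y = j}) \<ge> q * Q\<^sup>2 - q * Q" if "x \<in> S" for x
    using card_tangent_section_le[of x j] card_section_ge[of x j] that S_D[OF that] vzero_notin_S by auto
  have "(\<Sum>y\<in>S. (h y)\<^sup>2) = (\<Sum>p\<in>A \<times> A. real (card {y \<in> S. dot (fst p) y = j \<and> dot (snd p) y = j}))"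
    unfolding h_def by (subst sum_card_square) (simp_all add: sum.cartesian_product case_prod_unfold)
  \<comment> \<open>Each isotropic pair lowers the second moment by \<open>q Q\<close>;
    nonnegativity of the variance then limits how often this happens. The diagonal allowance
    \<open>q Q^2\<close> covers one tangent section.\<close>
  also have "\<dots> \<le> (\<Sum>p\<in>A \<times> A. (Q\<^sup>2 + 2 * Q) - q * Q * of_bool (fst p \<noteq> snd p \<and> dot (fst p) (snd p) = j)
      + q * Q\<^sup>2 * of_bool (fst p = snd p))"
  proof (rule sum_mono)
    fix p assume "p \<in> A \<times> A"
    then have p: "fst p \<in> S" "snd p \<in> S" using A by auto
    have "0 \<le> Q\<^sup>2" "0 \<le> Q" "Q \<le> q * Q" using Q_ge_1 q_ge_3 by auto
    then have ineq: "q * Q\<^sup>2 + Q - q * Q \<le> Q\<^sup>2 + 2 * Q + q * Q\<^sup>2" by linarith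
    show "real (card {y \<in> S. dot (fst p) y = j \<and> dot (snd p) y = j}) \<le>
       (Q\<^sup>2 + 2 * Q) - q * Q * of_bool (fst p \<noteq> snd p \<and> dot (fst p) (snd p) = j) + q * Q\<^sup>2 * of_bool (fst p = snd p)"
      using card_double_tangent_le[OF p] card_double_tangent_isotropic_le[OF p] tangent(1)[OF p(1)]
        ineq by (cases "fst p = snd p") auto
  qed
  also have "\<dots> = (\<Sum>p\<in>A \<times> A. Q\<^sup>2 + 2 * Q) - q * Q * (\<Sum>p\<in>A \<times> A. of_bool (fst p \<noteq> snd p \<and> dot (fst p) (snd p) = j))
      + q * Q\<^sup>2 * (\<Sum>p\<in>A \<times> A. of_bool (fst p = snd p))"
    by (simp add: sum.distrib sum_subtractf flip: sum_distrib_left)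
  also have "(\<Sum>p\<in>A \<times> A. of_bool (fst p \<noteq> snd p \<and> dot (fst p) (snd p) = j)) = real (card ?I)"
    by (simp add: sum_of_bool_eq Int_def)
  also have "(\<Sum>p\<in>A \<times> A. of_bool (fst p = snd p)) = (\<Sum>x\<in>A. \<Sum>y\<in>A. of_bool (x = y))"
    by (simp add: sum.cartesian_product case_prod_unfold)
  also have "\<dots> = ?a" by (simp add: sum_of_bool_eq)
  finally have sq: "(\<Sum>y\<in>S. (h y)\<^sup>2) \<le> ?a\<^sup>2 * (Q\<^sup>2 + 2 * Q) - q * Q * real (card ?I) + q * Q\<^sup>2 * ?a"
    by (simp add: card_cartesian_product power2_eq_square)
  have "(\<Sum>y\<in>S. h y) = (\<Sum>x\<in>A. real (card {y \<in> S. dot x y = j}))"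
    unfolding h_def by (rule sum_card_swap) auto
  also have "\<dots> \<ge> (\<Sum>x\<in>A. q * Q\<^sup>2 - q * Q)" using A by (intro sum_mono tangent(2)) auto
  finally have lin: "(\<Sum>y\<in>S. h y) \<ge> ?a * (q * Q\<^sup>2 - q * Q)" by simp
  \<comment> \<open>\<open>a/q\<close> is the expected value of \<open>h\<close>, since a tangent
    section holds about a fraction \<open>1/q\<close> of \<open>S\<close>; the terms of order
    \<open>a^2 Q^2\<close> cancel.\<close>
  have "0 \<le> (\<Sum>y\<in>S. (h y - ?a / q)\<^sup>2)" by (intro sum_nonneg) auto
  also have "\<dots> = (\<Sum>y\<in>S. (h y)\<^sup>2) - 2 * ?a / q * (\<Sum>y\<in>S. h y) + ?a\<^sup>2 / q\<^sup>2 * real (card S)"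
    unfolding sum_squared_deviation by (simp add: power_divide)
  finally have var: "0 \<le> (\<Sum>y\<in>S. (h y)\<^sup>2) - 2 * ?a / q * (\<Sum>y\<in>S. h y) + ?a\<^sup>2 / q\<^sup>2 * real (card S)" .
  have "2 * ?a / q * (?a * (q * Q\<^sup>2 - q * Q)) \<le> 2 * ?a / q * (\<Sum>y\<in>S. h y)"
    using lin q_ge_3 by (intro mult_left_mono) auto
  moreover have "2 * ?a / q * (?a * (q * Q\<^sup>2 - q * Q)) = 2 * ?a\<^sup>2 * (Q\<^sup>2 - Q)"
    using q_ge_3 by (simp add: field_simps power2_eq_square)
  moreover have "?a\<^sup>2 / q\<^sup>2 * real (card S) = ?a\<^sup>2 * Q\<^sup>2 - ?a\<^sup>2 * Q / q"
    unfolding card_S using q_ge_3 by (simp add: field_simps power2_eq_square)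
  moreover note var
  ultimately have "0 \<le> (\<Sum>y\<in>S. (h y)\<^sup>2) - 2 * ?a\<^sup>2 * (Q\<^sup>2 - Q) + (?a\<^sup>2 * Q\<^sup>2 - ?a\<^sup>2 * Q / q)"
    by linarith
  moreover have "?a\<^sup>2 * Q / q \<ge> 0" by simp
  ultimately have "0 \<le> (\<Sum>y\<in>S. (h y)\<^sup>2) - 2 * ?a\<^sup>2 * (Q\<^sup>2 - Q) + ?a\<^sup>2 * Q\<^sup>2" by linarith
  moreover have "0 \<le> ?a\<^sup>2 * Q" by simp
  ultimately have "q * Q * real (card ?I) \<le> q * Q\<^sup>2 * ?a + 4 * ?a\<^sup>2 * Q"
    using sq by (simp add: algebra_simps)
  also have "\<dots> = Q * (q * Q * ?a + 4 * ?a\<^sup>2)" by (simp add: algebra_simps power2_eq_square)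
  finally have "Q * (q * real (card ?I)) \<le> Q * (q * Q * ?a + 4 * ?a\<^sup>2)" by (simp add: mult_ac)
  moreover have "Q > 0" using Q_ge_1 by linarith
  ultimately show ?thesis by (simp only: mult_le_cancel_left_pos)
qed

section \<open>Additive energy\<close>

definition parallel :: "(nat \<Rightarrow> 'a) \<Rightarrow> (nat \<Rightarrow> 'a) \<Rightarrow> bool" where
  "parallel v w \<longleftrightarrow> (\<exists>l\<in>F. w = vscale l v)"

lemma vscale_vscale: "l \<in> F \<Longrightarrow> k \<in> F \<Longrightarrow> v \<in> V \<Longrightarrow> vscale l (vscale k v) = vscale (l \<otimes> k) v"
  by (rule vec_eqI) (simp_all add: m_assoc)

lemma vscale_one: "v \<in> V \<Longrightarrow> vscale \<one> v = v"
  by (rule vec_eqI) simp_all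

lemma vscale_cancel:
  assumes "l \<in> F" "k \<in> F" "v \<in> V" "v \<noteq> vzero" "vscale l v = vscale k v"
  shows "l = k"
proof -
  obtain w where w: "w \<in> V" "dot v w = \<one>" using dot_nondegenerate assms by blast
  have "dot (vscale l v) w = dot (vscale k v) w" by (simp only: assms(5))
  then show ?thesis using assms(1-4) w by (simp add: dot_simps)
qed

text \<open>\<open>parallel v w\<close> includes \<open>w = vzero\<close>, so for nonzero
  \<open>v\<close> its negation is exactly linear independence and the codimension-two count
  applies.\<close>

lemma card_two_hyperplanes_le:
  assumes "v \<in> V" "v \<noteq> vzero" "w \<in> V"
  shows "real (card {u \<in> V. dot v u = \<zero> \<and> dot w u = \<zero>})
    \<le> q * Q\<^sup>2 + (q\<^sup>2 * Q\<^sup>2 - q * Q\<^sup>2) * of_bool (parallel v w)"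
proof (cases "parallel v w")
  case True
  have "card {u \<in> V. dot v u = \<zero> \<and> dot w u = \<zero>} \<le> card {u \<in> V. dot v u = \<zero>}"
    by (intro card_mono) auto
  moreover have "q * real (card {u \<in> V. dot v u = \<zero>}) = q * (q\<^sup>2 * Q\<^sup>2)"
    using card_hyperplane[of v \<zero>] assms by (simp add: q_d power3_eq_cube power2_eq_square mult_ac)
  then have "real (card {u \<in> V. dot v u = \<zero>}) = q\<^sup>2 * Q\<^sup>2" using q_ge_3 by simp
  ultimately show ?thesis using True by simp
next
  case False
  have "vadd w (vscale b v) \<noteq> vzero" if b: "b \<in> F" for b
  proof
    assume "vadd w (vscale b v) = vzero"
    then have "w i \<oplus> b \<otimes> v i = \<zero>" if "i \<in> ind" for i using vec_nth(1,3,4) that by metis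
    then have "w = vscale (\<ominus> b) v"
      using assms b by (intro vec_eqI) (simp_all add: minus_equality[symmetric] l_minus)
    then show False using False b by (auto simp: parallel_def)
  qed
  then have "q\<^sup>2 * real (card {u \<in> V. dot w u = \<zero> \<and> dot v u = \<zero>}) = q\<^sup>2 * (q * Q\<^sup>2)"
    using card_codim_two[of w v] assms by (simp add: q_d power3_eq_cube power2_eq_square mult_ac)
  then show ?thesis using False q_ge_3 by (simp add: conj_commute)
qed

text \<open>Replacing \<open>B\<close> by all nonzero multiples of its vectors turns the count into a
  point-hyperplane incidence count in the projective space over \<open>V\<close>, which saves a factor
  \<open>\<surd>q\<close> over the affine one.\<close>

lemma orthogonal_pairs_le:
  assumes fB: "finite B" and B: "B \<subseteq> V" "vzero \<notin> B"
  shows "real (card {p \<in> B \<times> B. dot (fst p) (snd p) = \<zero>}) \<le> (real (card B))\<^sup>2 / q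
    + sqrt q * Q * real (card {p \<in> B \<times> B. parallel (fst p) (snd p)})"
proof -
  let ?b = "real (card B)" and ?P = "real (card {p \<in> B \<times> B. parallel (fst p) (snd p)})"
  \<comment> \<open>\<open>Z\<close> indexes the nonzero multiples of \<open>B\<close>,
    \<open>g u\<close> is the multiplicity of \<open>u\<close> among them, and \<open>H u\<close>
    counts the hyperplanes with normal in \<open>B\<close> through \<open>u\<close>.\<close>
  define Z where "Z = (F - {\<zero>}) \<times> B"
  define f where "f p = vscale (fst p) (snd p)" for p
  define g where "g u = real (card {p \<in> Z. f p = u})" for u
  define H where "H u = real (card {v \<in> B. dot v u = \<zero>})" for u
  \<comment> \<open>The bound on the variance of \<open>H\<close> is \<open>k^2\<close> times the
    bound on the sum of \<open>g^2\<close>, so with weight \<open>k\<close> both halves of the mean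
    inequality are equal.\<close>
  define k where "k = sqrt q * Q"
  have q1: "q > 1" using q_ge_3 by simp
  have k: "k > 0" "k\<^sup>2 = q * Q\<^sup>2" using q1 Q_ge_1 by (simp_all add: k_def power_mult_distrib)
  have [simp]: "finite Z" using fB by (simp add: Z_def)
  have cF: "real (card (F - {\<zero>})) = q - 1" using q1 by (simp add: order_def)
  have fX: "f p \<in> V" if "p \<in> Z" for p using that B by (auto simp: f_def Z_def)
  have P_eq: "(\<Sum>p\<in>B\<times>B. of_bool (parallel (fst p) (snd p))) = ?P"
    using fB by (simp add: sum_of_bool_eq Int_def)
  have Hsum: "(\<Sum>u\<in>V. g u * H u) = (q - 1) * (\<Sum>w\<in>B. H w)"
  proof -
    have "(\<Sum>u\<in>V. g u * H u) = (\<Sum>p\<in>Z. H (f p))" unfolding g_def by (rule sum_card_fibres) (auto simp: fX)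
    also have "\<dots> = (\<Sum>p\<in>Z. H (snd p))"
    proof (rule sum.cong)
      fix p assume "p \<in> Z"
      then have p: "fst p \<in> F" "fst p \<noteq> \<zero>" "snd p \<in> V" using B by (auto simp: Z_def)
      have "dot v (f p) = \<zero> \<longleftrightarrow> dot v (snd p) = \<zero>" if "v \<in> B" for v
        using p that B integral[of "fst p" "dot v (snd p)"] by (auto simp: f_def dot_simps)
      then show "H (f p) = H (snd p)" unfolding H_def by (metis (mono_tags, lifting) Collect_cong)
    qed simp
    also have "\<dots> = (\<Sum>l\<in>F - {\<zero>}. \<Sum>w\<in>B. H w)"
      by (simp only: Z_def sum.cartesian_product case_prod_unfold)
    finally show ?thesis using cF by simp
  qed
  have gsum: "(\<Sum>u\<in>V. g u) = (q - 1) * ?b"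
    using sum_card_fibres[of Z V f "\<lambda>_. 1"] fX cF fB by (simp add: g_def Z_def card_cartesian_product)
  have gsq: "(\<Sum>u\<in>V. (g u)\<^sup>2) \<le> (q - 1) * ?P"
  proof -
    have "(\<Sum>u\<in>V. (g u)\<^sup>2) = (\<Sum>u\<in>V. g u * real (card {p' \<in> Z. f p' = u}))"
      by (simp add: g_def power2_eq_square)
    also have "\<dots> = (\<Sum>p\<in>Z. real (card {p' \<in> Z. f p' = f p}))"
      unfolding g_def by (rule sum_card_fibres) (auto simp: fX)
    \<comment> \<open>If \<open>l w\<close> equals a given nonzero multiple of \<open>snd p\<close>,
      then \<open>w\<close> is parallel to \<open>snd p\<close> and determines
      \<open>l\<close>.\<close>
    also have "\<dots> \<le> (\<Sum>p\<in>Z. real (card {w \<in> B. parallel (snd p) w}))"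
    proof (rule sum_mono)
      fix p assume "p \<in> Z"
      then have p: "fst p \<in> F" "fst p \<noteq> \<zero>" "snd p \<in> V" using B by (auto simp: Z_def)
      have "card {p' \<in> Z. f p' = f p} \<le> card {w \<in> B. parallel (snd p) w}"
      proof (rule card_inj_on_le[where f = snd])
        show "inj_on snd {p' \<in> Z. f p' = f p}"
        proof (rule inj_onI)
          fix x y assume x: "x \<in> {p' \<in> Z. f p' = f p}" and y: "y \<in> {p' \<in> Z. f p' = f p}" and eq: "snd x = snd y"
          have "snd x \<in> V" "snd x \<noteq> vzero" using x B by (auto simp: Z_def)
          moreover have "fst x \<in> F" "fst y \<in> F" using x y by (auto simp: Z_def)
          moreover have "vscale (fst x) (snd x) = vscale (fst y) (snd x)" using x y eq by (simp add: f_def)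
          ultimately have "fst x = fst y" using vscale_cancel by blast
          then show "x = y" using eq by (simp add: prod_eq_iff)
        qed
        show "snd ` {p' \<in> Z. f p' = f p} \<subseteq> {w \<in> B. parallel (snd p) w}"
        proof safe
          fix l w assume lw: "(l, w) \<in> Z" "f (l, w) = f p"
          then have l: "l \<in> F" "l \<noteq> \<zero>" "w \<in> B" "w \<in> V" using B by (auto simp: Z_def)
          then have i: "inv l \<in> F" "inv l \<otimes> l = \<one>" using field_Units by auto
          have "vscale (inv l) (vscale l w) = vscale (inv l) (vscale (fst p) (snd p))"
            using lw by (simp add: f_def)
          then have "w = vscale (inv l \<otimes> fst p) (snd p)"
            using l i p by (simp add: vscale_vscale vscale_one)
          then show "parallel (snd p) (snd (l, w))" using i p by (auto simp: parallel_def)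
          show "snd (l, w) \<in> B" using l by simp
        qed
      qed (use fB in simp)
      then show "real (card {p' \<in> Z. f p' = f p}) \<le> real (card {w \<in> B. parallel (snd p) w})" by simp
    qed
    also have "\<dots> = (\<Sum>l\<in>F - {\<zero>}. \<Sum>v\<in>B. real (card {w \<in> B. parallel v w}))"
      by (simp only: Z_def sum.cartesian_product case_prod_unfold)
    also have "\<dots> = (q - 1) * ?P" using cF sum_card_Sigma[OF fB fB, of parallel] by simp
    finally show ?thesis .
  qed
  have hyper: "real (card {u \<in> V. dot v u = \<zero>}) = q\<^sup>2 * Q\<^sup>2" if "v \<in> B" for v
  proof -
    have "v \<in> V" "v \<noteq> vzero" using that B by auto
    then have "q * real (card {u \<in> V. dot v u = \<zero>}) = q * (q\<^sup>2 * Q\<^sup>2)"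
      using card_hyperplane[of v \<zero>] by (simp add: q_d power3_eq_cube power2_eq_square mult_ac)
    then show ?thesis using q1 by simp
  qed
  have H1: "(\<Sum>u\<in>V. H u) = ?b * (q\<^sup>2 * Q\<^sup>2)"
  proof -
    have "(\<Sum>u\<in>V. H u) = (\<Sum>v\<in>B. real (card {u \<in> V. dot v u = \<zero>}))"
      unfolding H_def by (rule sum_card_swap) (use fB in auto)
    then show ?thesis using hyper by simp
  qed
  have H2: "(\<Sum>u\<in>V. (H u)\<^sup>2) \<le> q * Q\<^sup>2 * ?b\<^sup>2 + (q\<^sup>2 * Q\<^sup>2 - q * Q\<^sup>2) * ?P"
  proof -
    have "(\<Sum>u\<in>V. (H u)\<^sup>2) = (\<Sum>p\<in>B\<times>B. real (card {u \<in> V. dot (fst p) u = \<zero> \<and> dot (snd p) u = \<zero>}))"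
      unfolding H_def using fB by (subst sum_card_square) (simp_all add: sum.cartesian_product case_prod_unfold)
    also have "\<dots> \<le> (\<Sum>p\<in>B\<times>B. q * Q\<^sup>2 + (q\<^sup>2 * Q\<^sup>2 - q * Q\<^sup>2) * of_bool (parallel (fst p) (snd p)))"
      using B by (intro sum_mono card_two_hyperplanes_le) auto
    also have "\<dots> = q * Q\<^sup>2 * ?b\<^sup>2 + (q\<^sup>2 * Q\<^sup>2 - q * Q\<^sup>2) * ?P"
      by (simp add: sum.distrib P_eq card_cartesian_product power2_eq_square flip: sum_distrib_left)
    finally show ?thesis .
  qed
  \<comment> \<open>Centring at \<open>b/q\<close> cancels the \<open>b^2\<close> terms exactly;
    only the excess of the parallel pairs is left.\<close>
  have var: "(\<Sum>u\<in>V. (H u - ?b / q)\<^sup>2) \<le> k\<^sup>2 * ((q - 1) * ?P)"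
  proof -
    have "(\<Sum>u\<in>V. (H u - ?b / q)\<^sup>2) = (\<Sum>u\<in>V. (H u)\<^sup>2) - 2 * (?b / q) * (\<Sum>u\<in>V. H u) + (?b / q)\<^sup>2 * q ^ d"
      unfolding sum_squared_deviation card_V by (simp add: mult.commute)
    also have "2 * (?b / q) * (\<Sum>u\<in>V. H u) = 2 * (q * Q\<^sup>2 * ?b\<^sup>2)"
      unfolding H1 using q1 by (simp add: field_simps power2_eq_square)
    also have "(?b / q)\<^sup>2 * q ^ d = q * Q\<^sup>2 * ?b\<^sup>2"
      unfolding q_d using q1 by (simp add: field_simps power2_eq_square power3_eq_cube)
    also have "(\<Sum>u\<in>V. (H u)\<^sup>2) - 2 * (q * Q\<^sup>2 * ?b\<^sup>2) + q * Q\<^sup>2 * ?b\<^sup>2 \<le> (q\<^sup>2 * Q\<^sup>2 - q * Q\<^sup>2) * ?P"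
      using H2 by linarith
    also have "\<dots> = k\<^sup>2 * ((q - 1) * ?P)" unfolding k(2) by (simp add: algebra_simps power2_eq_square)
    finally show ?thesis .
  qed
  have "(\<Sum>u\<in>V. g u * (H u - ?b / q)) \<le> (k * (\<Sum>u\<in>V. (g u)\<^sup>2) + (\<Sum>u\<in>V. (H u - ?b / q)\<^sup>2) / k) / 2"
    by (rule sum_mult_le_weighted_squares) (rule k)
  also have "\<dots> \<le> (k * ((q - 1) * ?P) + k\<^sup>2 * ((q - 1) * ?P) / k) / 2"
    using k(1) gsq var by (intro divide_right_mono add_mono mult_left_mono) auto
  also have "\<dots> = (q - 1) * (k * ?P)" using k(1) by (simp add: power2_eq_square)
  finally have dev: "(\<Sum>u\<in>V. g u * (H u - ?b / q)) \<le> (q - 1) * (k * ?P)" .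
  have "(\<Sum>u\<in>V. g u * (H u - ?b / q)) = (\<Sum>u\<in>V. g u * H u) - (\<Sum>u\<in>V. g u) * (?b / q)"
    by (simp only: right_diff_distrib sum_subtractf sum_distrib_right)
  also have "\<dots> = (q - 1) * ((\<Sum>w\<in>B. H w) - ?b\<^sup>2 / q)"
    unfolding Hsum gsum by (simp only: right_diff_distrib power2_eq_square times_divide_eq_right mult.assoc)
  finally have "(q - 1) * ((\<Sum>w\<in>B. H w) - ?b\<^sup>2 / q) \<le> (q - 1) * (k * ?P)" using dev by simp
  then have "(\<Sum>w\<in>B. H w) - ?b\<^sup>2 / q \<le> k * ?P" using q1 by simp
  moreover have "(\<Sum>w\<in>B. H w) = real (card {p \<in> B \<times> B. dot (fst p) (snd p) = \<zero>})"
  proof -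
    have "(\<Sum>w\<in>B. H w) = (\<Sum>w\<in>B. real (card {v \<in> B. dot w v = \<zero>}))"
      unfolding H_def by (rule sum_card_swap) (use fB in auto)
    then show ?thesis using sum_card_Sigma[OF fB fB, of "\<lambda>w v. dot w v = \<zero>"] by simp
  qed
  ultimately show ?thesis by (simp add: k_def)
qed

text \<open>Interprets \<open>dot x z = j\<close>: the direction \<open>x - z\<close> is isotropic,
  so for distinct points the line joining them lies in \<open>S\<close>.\<close>

lemma nrm_diff_S_eq_zero:
  assumes "x \<in> S" "z \<in> S"
  shows "nrm (vsub x z) = \<zero> \<longleftrightarrow> dot x z = j"
proof -
  note V = S_D(1)[OF assms(1)] S_D(1)[OF assms(2)]
  have eq: "nrm (vsub x z) = (j \<ominus> dot x z) \<oplus> (j \<ominus> dot x z)"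
    using V S_D(3)[OF assms(1)] S_D(3)[OF assms(2)] dot_comm[OF V]
    by (simp add: nrm_dot dot_simps minus_eq minus_add a_ac)
  show ?thesis unfolding eq using V double_eq_zero[of "j \<ominus> dot x z"] by auto
qed

text \<open>A line through \<open>z\<close> meets the quadric in at most one further point unless
  its direction is isotropic.\<close>

lemma parallel_differences:
  assumes "x \<in> S" "y \<in> S" "z \<in> S" "y \<noteq> z" and par: "parallel (vsub x z) (vsub y z)"
  shows "y = x \<or> dot x z = j"
proof -
  note V = S_D(1)[OF assms(1)] S_D(1)[OF assms(2)] S_D(1)[OF assms(3)]
  let ?v = "vsub x z"
  obtain l where l: "l \<in> F" "vsub y z = vscale l ?v" using par by (auto simp: parallel_def)
  \<comment> \<open>The factor \<open>k\<close> accounts for \<open>z\<close> itself. The other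
    factor is linear in \<open>k\<close> and vanishes both at 1, the parameter of \<open>x\<close>,
    and at \<open>l\<close>, the parameter of \<open>y\<close>.\<close>
  have sphere: "nrm (vadd (vscale k ?v) z) = k \<otimes> (k \<otimes> nrm ?v \<oplus> (dot ?v z \<oplus> dot ?v z)) \<oplus> j" if "k \<in> F" for k
    using V that S_D(3)[OF assms(3)] dot_comm[of z ?v]
    by (simp add: nrm_dot dot_simps(1,3,5,7) l_distr r_distr a_ac m_ac)
  have root: "k \<otimes> nrm ?v \<oplus> (dot ?v z \<oplus> dot ?v z) = \<zero>"
    if k: "k \<in> F" "k \<noteq> \<zero>" "vadd (vscale k ?v) z \<in> S" for k
  proof -
    let ?r = "k \<otimes> nrm ?v \<oplus> (dot ?v z \<oplus> dot ?v z)"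
    have "k \<otimes> ?r \<oplus> j = \<zero> \<oplus> j" using sphere[OF k(1)] S_D(2)[OF k(3)] by simp
    then have "k \<otimes> ?r = \<zero>" using V k by (subst (asm) add.right_cancel) auto
    then show ?thesis using V k integral[of k ?r] by auto
  qed
  have x1: "vadd (vscale \<one> ?v) z = x" using V by (simp add: vscale_one vadd_vsub)
  have yl: "vadd (vscale l ?v) z = y" using V l(2)[symmetric] by (simp add: vadd_vsub)
  have "l \<noteq> \<zero>"
  proof
    assume "l = \<zero>"
    then have "vsub y z = vzero" using V l(2) by (intro vec_eqI) simp_all
    then show False using vsub_eq_zero_iff V assms by simp
  qed
  then have "l \<otimes> nrm ?v \<oplus> (dot ?v z \<oplus> dot ?v z) = \<one> \<otimes> nrm ?v \<oplus> (dot ?v z \<oplus> dot ?v z)"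
    using root[OF l(1)] root[OF one_closed] x1 yl assms by simp
  then have "l \<otimes> nrm ?v = \<one> \<otimes> nrm ?v" using V l by (subst (asm) add.right_cancel) auto
  then have "nrm ?v = \<zero> \<or> l = \<one>"
    using V l m_rcancel[of "nrm ?v" l \<one>] by auto
  then show ?thesis
  proof
    assume "nrm ?v = \<zero>"
    then show ?thesis using nrm_diff_S_eq_zero assms by simp
  next
    assume "l = \<one>"
    then show ?thesis using x1 yl by simp
  qed
qed

text \<open>Moving \<open>z\<close> to the origin, \<open>orthogonal_pairs_le\<close> applies to the
  differences. By \<open>parallel_differences\<close> a parallel pair is diagonal, or its first
  entry comes from a point joined to \<open>z\<close> by a line in \<open>S\<close> and has at most
  \<open>q\<close> multiples. Pairs containing \<open>z\<close> account for the last term.\<close>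

lemma right_angles_at_le:
  assumes A: "A \<subseteq> S" and z: "z \<in> A"
  shows "real (card {p \<in> A \<times> A. dot (vsub (fst p) z) (vsub (snd p) z) = \<zero>}) \<le>
    (real (card A))\<^sup>2 / q + sqrt q * Q * (real (card A) + q * real (card {x \<in> A. z \<noteq> x \<and> dot z x = j}))
    + 2 * real (card A)"
proof -
  let ?a = "real (card A)" and ?I = "{x \<in> A. z \<noteq> x \<and> dot z x = j}"
  define t where "t x = vsub x z" for x
  define B where "B = t ` (A - {z})"
  have fA: "finite A" using A finite_S finite_subset by blast
  have AV: "x \<in> V" if "x \<in> A" for x using that A S_D(1) by blast
  have inj: "inj_on t A"
  proof (rule inj_onI)
    fix x y assume "x \<in> A" "y \<in> A" "t x = t y"
    then have "vadd (t x) z = vadd (t y) z" "x \<in> V" "y \<in> V" using AV by auto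
    then show "x = y" using AV[OF z] by (simp add: t_def vadd_vsub)
  qed
  have B: "finite B" "B \<subseteq> V" "vzero \<notin> B" "card B \<le> card A"
  proof -
    show "finite B" "B \<subseteq> V" using fA AV z by (auto simp: B_def t_def)
    show "vzero \<notin> B"
    proof
      assume "vzero \<in> B"
      then obtain x where x: "x \<in> A" "x \<noteq> z" "vzero = vsub x z" unfolding B_def t_def by blast
      then show False using vsub_eq_zero_iff[OF AV[OF x(1)] AV[OF z]] by simp
    qed
    have "card B \<le> card (A - {z})" unfolding B_def using fA by (intro card_image_le) auto
    also have "\<dots> \<le> card A" using fA by (intro card_mono) auto
    finally show "card B \<le> card A" .
  qed
  have par: "card {p \<in> B \<times> B. parallel (fst p) (snd p)} \<le> card A + card F * card ?I"
  proof -
    have "{p \<in> B \<times> B. parallel (fst p) (snd p)} \<subseteq> (\<lambda>x. (t x, t x)) ` A \<union> (\<lambda>(l, x). (t x, vscale l (t x))) ` (F \<times> ?I)"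
    proof
      fix p assume "p \<in> {p \<in> B \<times> B. parallel (fst p) (snd p)}"
      then obtain v w where vw: "p = (v, w)" "v \<in> B" "w \<in> B" "parallel v w" by (cases p) auto
      obtain x where x: "x \<in> A" "x \<noteq> z" "v = t x" using vw(2) unfolding B_def by blast
      obtain y where y: "y \<in> A" "y \<noteq> z" "w = t y" using vw(3) unfolding B_def by blast
      have xy: "x \<in> A" "y \<in> A" "x \<noteq> z" "y \<noteq> z" "p = (t x, t y)" "parallel (t x) (t y)"
        using vw x y by simp_all
      then have "y = x \<or> dot x z = j"
        using parallel_differences[of x y z] A z by (auto simp: t_def)
      then show "p \<in> (\<lambda>x. (t x, t x)) ` A \<union> (\<lambda>(l, x). (t x, vscale l (t x))) ` (F \<times> ?I)"
      proof
        assume "dot x z = j"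
        then have "x \<in> ?I" using xy dot_comm[OF AV AV] z by auto
        then show ?thesis using xy by (force simp: parallel_def)
      qed (use xy in auto)
    qed
    then have "card {p \<in> B \<times> B. parallel (fst p) (snd p)} \<le>
        card ((\<lambda>x. (t x, t x)) ` A \<union> (\<lambda>(l, x). (t x, vscale l (t x))) ` (F \<times> ?I))"
      using fA by (intro card_mono) auto
    also have "\<dots> \<le> card ((\<lambda>x. (t x, t x)) ` A) + card ((\<lambda>(l, x). (t x, vscale l (t x))) ` (F \<times> ?I))"
      by (rule card_Un_le)
    also have "\<dots> \<le> card A + card (F \<times> ?I)"
      using fA by (intro add_mono card_image_le) auto
    finally show ?thesis by (simp add: card_cartesian_product)
  qed
  have "card {p \<in> A \<times> A. dot (t (fst p)) (t (snd p)) = \<zero>} \<le>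
     card ({p \<in> (A - {z}) \<times> (A - {z}). dot (t (fst p)) (t (snd p)) = \<zero>} \<union> ({z} \<times> A \<union> A \<times> {z}))"
    using fA by (intro card_mono) auto
  also have "\<dots> \<le> card {p \<in> (A - {z}) \<times> (A - {z}). dot (t (fst p)) (t (snd p)) = \<zero>} + card ({z} \<times> A \<union> A \<times> {z})"
    by (rule card_Un_le)
  also have "card {p \<in> (A - {z}) \<times> (A - {z}). dot (t (fst p)) (t (snd p)) = \<zero>}
      \<le> card {p \<in> B \<times> B. dot (fst p) (snd p) = \<zero>}"
  proof (rule card_inj_on_le[where f = "map_prod t t"])
    show "inj_on (map_prod t t) {p \<in> (A - {z}) \<times> (A - {z}). dot (t (fst p)) (t (snd p)) = \<zero>}"
      by (rule inj_on_subset[OF map_prod_inj_on[OF inj inj]]) auto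
  qed (use B in \<open>auto simp: B_def\<close>)
  also have "card ({z} \<times> A \<union> A \<times> {z}) \<le> card ({z} \<times> A) + card (A \<times> {z})" by (rule card_Un_le)
  also have "\<dots> = 2 * card A" by (simp add: card_cartesian_product)
  finally have "card {p \<in> A \<times> A. dot (t (fst p)) (t (snd p)) = \<zero>} \<le>
     card {p \<in> B \<times> B. dot (fst p) (snd p) = \<zero>} + 2 * card A" by simp
  then have "real (card {p \<in> A \<times> A. dot (t (fst p)) (t (snd p)) = \<zero>}) \<le>
     real (card {p \<in> B \<times> B. dot (fst p) (snd p) = \<zero>}) + 2 * ?a" by linarith
  also have "real (card {p \<in> B \<times> B. dot (fst p) (snd p) = \<zero>}) \<le> (real (card B))\<^sup>2 / q
    + sqrt q * Q * real (card {p \<in> B \<times> B. parallel (fst p) (snd p)})"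
    by (rule orthogonal_pairs_le) (use B in auto)
  also have "\<dots> \<le> ?a\<^sup>2 / q + sqrt q * Q * (?a + q * real (card ?I))"
  proof (intro add_mono divide_right_mono mult_left_mono power_mono)
    have "real (card {p \<in> B \<times> B. parallel (fst p) (snd p)}) \<le> real (card A + card F * card ?I)"
      using par by (simp only: of_nat_le_iff)
    then show "real (card {p \<in> B \<times> B. parallel (fst p) (snd p)}) \<le> ?a + q * real (card ?I)"
      by (simp add: order_def)
  qed (use B in auto)
  finally show ?thesis by (simp add: t_def)
qed

section \<open>Representation counts and the energy of pairs\<close>

text \<open>The \<open>n\<close>-fold convolution power of the indicator of \<open>A\<close>: the
  number of ordered \<open>n\<close>-tuples from \<open>A\<close> with sum \<open>u\<close>.\<close>

primrec rep :: "(nat \<Rightarrow> 'a) set \<Rightarrow> nat \<Rightarrow> (nat \<Rightarrow> 'a) \<Rightarrow> real" where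
  "rep A 0 u = of_bool (u = vzero)"
| "rep A (Suc n) u = (\<Sum>x\<in>A. rep A n (vsub u x))"

definition energy :: "(nat \<Rightarrow> 'a) set \<Rightarrow> nat \<Rightarrow> real" where
  "energy A n = (\<Sum>u\<in>V. (rep A n u)\<^sup>2)"

text \<open>If \<open>y + x = w + z\<close> with all four points on \<open>S\<close>, then
  \<open>w = y + x - z\<close> having norm \<open>j\<close> forces \<open>x - z\<close> and
  \<open>y - z\<close> to be orthogonal. So the energy is at most the number of right angles, summed
  over the vertex \<open>z\<close>.\<close>

lemma energy_two_le:
  assumes A: "A \<subseteq> S" and large: "q * Q \<le> real (card A)"
  shows "energy A 2 \<le> (real (card A)) ^ 3 / q + 8 * (sqrt q * Q) * (real (card A))\<^sup>2"
proof -
  let ?a = "real (card A)" and ?k = "sqrt q * Q"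
  have fA [simp]: "finite A" using A finite_S finite_subset by blast
  have AV: "x \<in> V" if "x \<in> A" for x using that A S_D(1) by blast
  have rep2: "rep A 2 u = real (card {x \<in> A. vsub u x \<in> A})" if u: "u \<in> V" for u
  proof -
    have rep1: "rep A 1 w = of_bool (w \<in> A)" if w: "w \<in> V" for w
    proof -
      have "rep A 1 w = (\<Sum>x\<in>A. of_bool (w = x))"
        using vsub_eq_zero_iff[OF w AV] by (simp add: cong: sum.cong)
      also have "\<dots> = of_bool (w \<in> A)" by (simp add: sum_of_bool_eq)
      finally show ?thesis .
    qed
    have "rep A 2 u = (\<Sum>x\<in>A. rep A 1 (vsub u x))" by (simp add: numeral_2_eq_2)
    also have "\<dots> = (\<Sum>x\<in>A. of_bool (vsub u x \<in> A))" using rep1 u AV by (intro sum.cong) auto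
    finally show ?thesis by (simp add: sum_of_bool_eq Int_def)
  qed
  have right_angle: "dot (vsub x z) (vsub y z) = \<zero>" if S: "x \<in> S" "y \<in> S" "z \<in> S" "vsub (vadd y x) z \<in> S" for x y z
  proof -
    note V = S_D(1)[OF S(1)] S_D(1)[OF S(2)] S_D(1)[OF S(3)]
    let ?e = "dot (vsub x z) (vsub y z)"
    have "nrm (vsub (vadd y x) z) \<oplus> dot z z = ?e \<oplus> ?e \<oplus> (dot x x \<oplus> dot y y)"
      using V dot_comm[OF V(1,2)] dot_comm[OF V(3,1)] dot_comm[OF V(3,2)]
      by (simp add: nrm_dot dot_simps minus_eq minus_add a_ac)
    then have "?e \<oplus> ?e = \<zero>"
      using S_D(2)[OF S(4)] S_D(3)[OF S(1)] S_D(3)[OF S(2)] S_D(3)[OF S(3)] V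
        add.right_cancel[of "j \<oplus> j" "?e \<oplus> ?e" \<zero>] by simp
    then show ?thesis using V double_eq_zero by auto
  qed
  have "energy A 2 = (\<Sum>u\<in>V. (real (card {x \<in> A. vsub u x \<in> A}))\<^sup>2)"
    unfolding energy_def using rep2 by simp
  also have "\<dots> = (\<Sum>x\<in>A. \<Sum>z\<in>A. real (card {u \<in> V. vsub u x \<in> A \<and> vsub u z \<in> A}))"
    by (rule sum_card_square) auto
  also have "\<dots> \<le> (\<Sum>x\<in>A. \<Sum>z\<in>A. real (card {y \<in> A. dot (vsub x z) (vsub y z) = \<zero>}))"
  proof (intro sum_mono)
    fix x z assume x: "x \<in> A" and z: "z \<in> A"
    have "card {u \<in> V. vsub u x \<in> A \<and> vsub u z \<in> A} \<le> card {y \<in> A. dot (vsub x z) (vsub y z) = \<zero>}"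
    proof (rule card_inj_on_le[where f = "\<lambda>u. vsub u x"])
      show "inj_on (\<lambda>u. vsub u x) {u \<in> V. vsub u x \<in> A \<and> vsub u z \<in> A}"
        by (rule inj_on_inverseI[where g = "\<lambda>y. vadd y x"]) (use AV[OF x] in \<open>simp add: vadd_vsub\<close>)
      show "(\<lambda>u. vsub u x) ` {u \<in> V. vsub u x \<in> A \<and> vsub u z \<in> A} \<subseteq> {y \<in> A. dot (vsub x z) (vsub y z) = \<zero>}"
        using right_angle[of x _ z] A x z AV[OF x] by (auto simp: vadd_vsub subset_iff)
    qed simp
    then show "real (card {u \<in> V. vsub u x \<in> A \<and> vsub u z \<in> A}) \<le> real (card {y \<in> A. dot (vsub x z) (vsub y z) = \<zero>})"
      by simp
  qed
  also have "\<dots> = (\<Sum>z\<in>A. \<Sum>x\<in>A. real (card {y \<in> A. dot (vsub x z) (vsub y z) = \<zero>}))" by (rule sum.swap)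
  also have "\<dots> = (\<Sum>z\<in>A. real (card {p \<in> A \<times> A. dot (vsub (fst p) z) (vsub (snd p) z) = \<zero>}))"
    by (intro sum.cong sum_card_Sigma) auto
  also have "\<dots> \<le> (\<Sum>z\<in>A. ?a\<^sup>2 / q + ?k * (?a + q * real (card {x \<in> A. z \<noteq> x \<and> dot z x = j})) + 2 * ?a)"
    using A by (intro sum_mono right_angles_at_le) auto
  also have "\<dots> = ?a * (?a\<^sup>2 / q + 2 * ?a) + ?k * (?a\<^sup>2 + q * (\<Sum>z\<in>A. real (card {x \<in> A. z \<noteq> x \<and> dot z x = j})))"
    by (simp add: sum.distrib sum_distrib_left algebra_simps power2_eq_square)
  also have "(\<Sum>z\<in>A. real (card {x \<in> A. z \<noteq> x \<and> dot z x = j})) =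
      real (card {p \<in> A \<times> A. fst p \<noteq> snd p \<and> dot (fst p) (snd p) = j})"
    by (rule sum_card_Sigma) auto
  \<comment> \<open>Largeness enters here: \<open>q Q a\<close> is at most \<open>a^2\<close>, so
    the number of isotropic pairs is at most \<open>5 a^2 / q\<close>.\<close>
  also have "?a * (?a\<^sup>2 / q + 2 * ?a) + ?k * (?a\<^sup>2 + q * \<dots>) \<le> ?a * (?a\<^sup>2 / q + 2 * ?a) + ?k * (?a\<^sup>2 + 5 * ?a\<^sup>2)"
  proof -
    have "q * Q * ?a \<le> ?a * ?a" using large by (intro mult_right_mono) auto
    then have "q * real (card {p \<in> A \<times> A. fst p \<noteq> snd p \<and> dot (fst p) (snd p) = j}) \<le> 5 * ?a\<^sup>2"
      using isotropic_pairs_le[OF A] by (simp add: power2_eq_square)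
    then show ?thesis by (intro add_left_mono mult_left_mono) auto
  qed
  also have "\<dots> = ?a ^ 3 / q + 2 * ?a\<^sup>2 + 6 * ?k * ?a\<^sup>2"
    by (simp add: algebra_simps power2_eq_square power3_eq_cube)
  \<comment> \<open>The degenerate pairs are absorbed because \<open>sqrt q Q\<close> is at least 1;
    this gives the coefficient \<open>8 = 6 + 2\<close>.\<close>
  also have "2 * ?a\<^sup>2 \<le> 2 * ?k * ?a\<^sup>2"
  proof -
    have "1 * 1 \<le> ?k" using q_ge_3 Q_ge_1 by (intro mult_mono) auto
    then show ?thesis by (simp add: mult_left_le_imp_le mult_right_mono)
  qed
  finally show ?thesis by simp
qed

section \<open>Sums of several points\<close>

lemma double_inject: "x \<in> F \<Longrightarrow> y \<in> F \<Longrightarrow> x \<oplus> x = y \<oplus> y \<Longrightarrow> x = y"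
proof -
  assume F: "x \<in> F" "y \<in> F" and eq: "x \<oplus> x = y \<oplus> y"
  have "(x \<ominus> y) \<oplus> (x \<ominus> y) = (x \<oplus> x) \<ominus> (y \<oplus> y)" using F by (simp add: minus_eq minus_add a_ac)
  then have "x \<ominus> y = \<zero>" using double_eq_zero[of "x \<ominus> y"] F eq by simp
  then show "x = y" using F by simp
qed

lemma sum_eq_sum_imp_minus_eq:
  assumes F: "x \<in> F" "y \<in> F" "z \<in> F" "w \<in> F" and eq: "x \<oplus> y = z \<oplus> w"
  shows "y \<ominus> w = z \<ominus> x"
proof -
  have "(y \<ominus> w) \<oplus> (w \<oplus> x) = (z \<ominus> x) \<oplus> (x \<oplus> w)"
    using F eq a_comm[OF F(1,2)] by (simp add: minus_eq a_assoc r_neg1)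
  then show ?thesis using F a_comm[of x w] by simp
qed

text \<open>One point of \<open>T\<close> fixes the level, so \<open>T\<close> lies in a single
  hyperplane section. The doubled product is what subtracting two norm equations produces; odd
  characteristic removes the factor 2.\<close>

lemma card_quadric_section_le:
  assumes w: "w \<in> V" "w \<noteq> vzero" and T: "T \<subseteq> S" and e: "e \<in> F" and eq: "\<And>x. x \<in> T \<Longrightarrow> dot w x \<oplus> dot w x = e"
  shows "real (card T) \<le> q * Q\<^sup>2 + Q"
proof (cases "T = {}")
  case True
  then show ?thesis using q_ge_3 by simp
next
  case False
  then obtain y where y: "y \<in> T" by blast
  have TV: "x \<in> V" if "x \<in> T" for x using that T S_D(1) by blast
  have "dot w x = dot w y" if "x \<in> T" for x
    by (rule double_inject) (use w TV[OF that] TV[OF y] eq[OF that] eq[OF y] in simp_all)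
  then have "T \<subseteq> {x \<in> S. dot w x = dot w y}" using T by blast
  then have "card T \<le> card {x \<in> S. dot w x = dot w y}" by (rule card_mono[rotated]) simp
  moreover have "real (card {x \<in> S. dot w x = dot w y}) \<le> q * Q\<^sup>2 + Q"
    by (rule card_section_le[OF w]) (use w TV[OF y] in simp)
  ultimately show ?thesis by linarith
qed

lemma nrm_vadd:
  assumes "x \<in> V" "y \<in> V"
  shows "nrm (vadd x y) = nrm x \<oplus> (dot y x \<oplus> dot y x) \<oplus> nrm y"
  using assms dot_comm[of x y] by (simp add: nrm_dot dot_simps a_ac)

lemma card_S_le: "real (card S) \<le> q\<^sup>2 * Q\<^sup>2"
  using q_ge_3 by (simp add: card_S)

text \<open>Two distinct translates of \<open>S\<close> meet where the difference of their equations
  vanishes, which is a hyperplane section; its size is the collision bound \<open>t\<close> in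
  \<open>weighted_collisions_le\<close>.\<close>

lemma sphere_convolution_le:
  assumes nonneg: "\<And>u. u \<in> V \<Longrightarrow> f u \<ge> 0"
  shows "(\<Sum>u\<in>V. (\<Sum>x\<in>S. f (vsub u x))\<^sup>2) \<le>
    real (card S) * (\<Sum>u\<in>V. (f u)\<^sup>2) + (q * Q\<^sup>2 + Q) * (\<Sum>u\<in>V. f u)\<^sup>2"
proof -
  have reindex: "(\<Sum>x\<in>S. f (vsub u x)) = (\<Sum>b\<in>V. f b * of_bool (vsub u b \<in> S))" if u: "u \<in> V" for u
  proof -
    have inv: "vsub u (vsub u x) = x" if "x \<in> V" for x
      using u that by (intro vec_eqI) (simp_all add: minus_eq minus_add a_assoc[symmetric] r_neg)
    have "(\<Sum>x\<in>S. f (vsub u x)) = (\<Sum>b\<in>{b \<in> V. vsub u b \<in> S}. f b)"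
      by (rule sum.reindex_bij_witness[where i = "vsub u" and j = "vsub u"]) (use u S_D(1) inv in auto)
    also have "\<dots> = (\<Sum>b\<in>V. if vsub u b \<in> S then f b else 0)"
      by (rule sum.inter_filter) simp
    also have "\<dots> = (\<Sum>b\<in>V. f b * of_bool (vsub u b \<in> S))" by (intro sum.cong) auto
    finally show ?thesis .
  qed
  have "(\<Sum>u\<in>V. (\<Sum>x\<in>S. f (vsub u x))\<^sup>2) = (\<Sum>u\<in>V. (\<Sum>b\<in>V. f b * of_bool (vsub u b \<in> S))\<^sup>2)"
    using reindex by simp
  also have "\<dots> \<le> real (card S) * (\<Sum>u\<in>V. (f u)\<^sup>2) + (q * Q\<^sup>2 + Q) * (\<Sum>u\<in>V. f u)\<^sup>2"
  proof (rule weighted_collisions_le)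
    fix b assume b: "b \<in> V"
    have "card {u \<in> V. vsub u b \<in> S} \<le> card S"
    proof (rule card_inj_on_le[where f = "\<lambda>u. vsub u b"])
      show "inj_on (\<lambda>u. vsub u b) {u \<in> V. vsub u b \<in> S}"
        by (rule inj_on_inverseI[where g = "\<lambda>y. vadd y b"]) (use b in \<open>simp add: vadd_vsub\<close>)
    qed auto
    then show "real (card {u \<in> V. vsub u b \<in> S}) \<le> real (card S)" by simp
    fix c assume c: "c \<in> V" and ne: "b \<noteq> c"
    let ?w = "vsub b c"
    have w: "?w \<in> V" "?w \<noteq> vzero" using b c ne vsub_eq_zero_iff by auto
    let ?T = "(\<lambda>u. vsub u b) ` {u \<in> V. vsub u b \<in> S \<and> vsub u c \<in> S}"
    have "real (card ?T) \<le> q * Q\<^sup>2 + Q"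
    proof (rule card_quadric_section_le[OF w])
      fix x assume "x \<in> ?T"
      then obtain u where u: "u \<in> V" "vsub u b \<in> S" "vsub u c \<in> S" "x = vsub u b" by blast
      have x: "x \<in> V" "nrm x = j" using u S_D(2) b by auto
      have "vsub u c = vadd x ?w"
        unfolding u(4) using u(1) b c
        by (intro vec_eqI) (simp_all add: minus_eq a_assoc r_neg2 l_neg r_neg1)
      then have "j = nrm x \<oplus> (dot ?w x \<oplus> dot ?w x) \<oplus> nrm ?w" using nrm_vadd[OF x(1) w(1)] S_D(2)[OF u(3)] by simp
      then have "\<zero> \<oplus> j = ((dot ?w x \<oplus> dot ?w x) \<oplus> nrm ?w) \<oplus> j" using x w b c by (simp add: a_ac)
      then have "\<zero> = (dot ?w x \<oplus> dot ?w x) \<oplus> nrm ?w"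
        using x w by (subst (asm) add.right_cancel) auto
      then show "dot ?w x \<oplus> dot ?w x = \<ominus> nrm ?w"
        using minus_equality[of "dot ?w x \<oplus> dot ?w x" "nrm ?w"] x w by simp
    qed (use w in auto)
    moreover have "card ?T = card {u \<in> V. vsub u b \<in> S \<and> vsub u c \<in> S}"
      by (intro card_image inj_on_inverseI[where g = "\<lambda>y. vadd y b"]) (use b in \<open>simp add: vadd_vsub\<close>)
    ultimately show "real (card {u \<in> V. vsub u b \<in> S \<and> vsub u c \<in> S}) \<le> q * Q\<^sup>2 + Q" by simp
  qed (use nonneg q_ge_3 in auto)
  finally show ?thesis .
qed

lemma sum_translate: "x \<in> V \<Longrightarrow> (\<Sum>u\<in>V. f (vsub u x)) = (\<Sum>u\<in>V. f u)" for f :: "_ \<Rightarrow> real"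
  by (rule sum.reindex_bij_witness[where i = "\<lambda>u. vadd u x" and j = "\<lambda>u. vsub u x"])
    (simp_all add: vsub_vadd vadd_vsub)

lemma rep_nonneg: "rep A n u \<ge> 0"
  by (induction n arbitrary: u) (auto intro: sum_nonneg)

lemma sum_rep:
  assumes "A \<subseteq> V" shows "(\<Sum>u\<in>V. rep A n u) = real (card A) ^ n"
proof (induction n)
  case 0
  have "V \<inter> {u. u = vzero} = {vzero}" by auto
  then show ?case by (simp add: sum_of_bool_eq)
next
  case (Suc n)
  have "(\<Sum>u\<in>V. rep A (Suc n) u) = (\<Sum>x\<in>A. \<Sum>u\<in>V. rep A n (vsub u x))"
    by simp (rule sum.swap)
  also have "\<dots> = (\<Sum>x\<in>A. real (card A) ^ n)" using assms sum_translate Suc by (intro sum.cong) auto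
  finally show ?case by simp
qed

lemma sum_rep_nrm:
  assumes "A \<subseteq> V" "x \<in> V"
  shows "(\<Sum>t\<in>F. \<Sum>u\<in>V. rep A n u * of_bool (nrm (vadd u x) = t)) = real (card A) ^ n"
proof -
  have "(\<Sum>t\<in>F. \<Sum>u\<in>V. rep A n u * of_bool (nrm (vadd u x) = t)) =
      (\<Sum>u\<in>V. \<Sum>t\<in>F. rep A n u * of_bool (nrm (vadd u x) = t))"
    by (rule sum.swap)
  also have "\<dots> = (\<Sum>u\<in>V. rep A n u)"
  proof (rule sum.cong)
    fix u assume u: "u \<in> V"
    have "(\<Sum>t\<in>F. rep A n u * of_bool (nrm (vadd u x) = t)) = (\<Sum>t\<in>F. if nrm (vadd u x) = t then rep A n u else 0)"
      by (intro sum.cong) auto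
    then show "(\<Sum>t\<in>F. rep A n u * of_bool (nrm (vadd u x) = t)) = rep A n u"
      using u assms by simp
  qed simp
  finally show ?thesis using sum_rep[OF assms(1)] by simp
qed

lemma vec_sum_closed:
  assumes "\<forall>i\<in>{1..n}. P i \<in> V" shows "vec_sum R d n P \<in> V"
  unfolding vec_sum_def ind_def[symmetric] using assms by (intro restrict_closed finsum_closed) auto

lemma vec_sum_nth: "i \<in> ind \<Longrightarrow> vec_sum R d n P i = (\<Oplus>k\<in>{1..n}. P k i)"
  by (simp add: vec_sum_def ind_def)

text \<open>Links \<open>rep\<close> to the tuples in the definition of \<open>Delta\<close>, by
  peeling off the last summand.\<close>

lemma rep_nonzero_vec_sum:
  assumes A: "A \<subseteq> V" and u: "u \<in> V" "rep A n u \<noteq> 0"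
  shows "\<exists>P. (\<forall>i\<in>{1..n}. P i \<in> A) \<and> vec_sum R d n P = u"
  using u
proof (induction n arbitrary: u)
  case 0
  then show ?case by (auto simp: vec_sum_def vzero_def ind_def split: if_splits)
next
  case (Suc n)
  then obtain x where x: "x \<in> A" "rep A n (vsub u x) \<noteq> 0" by (auto elim: sum.not_neutral_contains_not_neutral)
  have xV: "x \<in> V" using x A by blast
  then obtain P where P: "\<forall>i\<in>{1..n}. P i \<in> A" "vec_sum R d n P = vsub u x"
    using Suc.IH[of "vsub u x"] Suc.prems(1) x(2) vec_closed(2) by blast
  define P' where "P' = P(Suc n := x)"
  have P'A: "\<forall>i\<in>{1..Suc n}. P' i \<in> A" using P x by (auto simp: P'_def le_Suc_eq)
  have "vec_sum R d (Suc n) P' = vadd (vec_sum R d n P) x"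
  proof (rule vec_eqI)
    show "vec_sum R d (Suc n) P' \<in> V" using P'A A by (intro vec_sum_closed) blast
    have PV: "vec_sum R d n P \<in> V" using P A by (intro vec_sum_closed) blast
    then show "vadd (vec_sum R d n P) x \<in> V" using xV by simp
    fix i assume i: "i \<in> ind"
    have PF: "P k i \<in> F" if "k \<in> {1..n}" for k using P A i that by (meson nth_closed subsetD)
    have "{1..Suc n} = insert (Suc n) {1..n}" by auto
    then have "(\<Oplus>k\<in>{1..Suc n}. P' k i) = P' (Suc n) i \<oplus> (\<Oplus>k\<in>{1..n}. P' k i)"
      using PF xV i by (simp add: finsum_insert P'_def Pi_def)
    also have "(\<Oplus>k\<in>{1..n}. P' k i) = (\<Oplus>k\<in>{1..n}. P k i)"
      using PF by (intro finsum_cong') (auto simp: P'_def)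
    finally have "(\<Oplus>k\<in>{1..Suc n}. P' k i) = x i \<oplus> (\<Oplus>k\<in>{1..n}. P k i)" by (simp add: P'_def)
    moreover have "(\<Oplus>k\<in>{1..n}. P k i) \<in> F" using PF by (intro finsum_closed) auto
    ultimately show "vec_sum R d (Suc n) P' i = vadd (vec_sum R d n P) x i"
      using i xV vec_sum_nth[OF i] by (simp add: a_comm)
  qed
  then have "vec_sum R d (Suc n) P' = u" using P xV Suc by (simp add: vadd_vsub)
  then show ?case using P'A by blast
qed

section \<open>Recursion for the energy and the pinned second moment\<close>

lemma energy_nonneg: "energy A n \<ge> 0"
  unfolding energy_def by (intro sum_nonneg) auto

text \<open>One of the two factors \<open>rep A (Suc n)\<close> is enlarged to \<open>g\<close>, the
  convolution of \<open>rep A n\<close> with all of \<open>S\<close>. The mean \<open>c\<close> of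
  \<open>g\<close> gives the main term, and \<open>sphere_convolution_le\<close> controls its
  variance.\<close>

lemma energy_Suc_le:
  assumes A: "A \<subseteq> S" and large: "q * Q \<le> real (card A)"
  shows "energy A (Suc n) \<le> 5 * real (card A) ^ (2 * n + 1) / q + q\<^sup>2 * Q\<^sup>2 * energy A n"
proof -
  let ?a = "real (card A)" and ?s = "real (card S)" and ?D = "q ^ 3 * Q\<^sup>2"
  have AV: "A \<subseteq> V" using A S_D(1) by blast
  have q0: "q > 0" "Q > 0" using q_ge_3 by auto
  define M where "M = ?a ^ n"
  define g where "g u = (\<Sum>x\<in>S. rep A n (vsub u x))" for u
  define c where "c = ?s * M / ?D"
  have Msq: "?a ^ (2 * n + 1) = ?a * M\<^sup>2" by (simp only: M_def power_even_eq[symmetric] power_Suc[symmetric] Suc_eq_plus1)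
  have rep_le: "rep A (Suc n) u \<le> g u" for u
    unfolding g_def using A by (simp) (intro sum_mono2, auto simp: rep_nonneg)
  have sum_g: "(\<Sum>u\<in>V. g u) = ?s * M"
  proof -
    have "(\<Sum>u\<in>V. g u) = (\<Sum>x\<in>S. \<Sum>u\<in>V. rep A n (vsub u x))" unfolding g_def by (rule sum.swap)
    also have "\<dots> = (\<Sum>x\<in>S. M)" using S_D(1) sum_translate sum_rep[OF AV] by (intro sum.cong) (auto simp: M_def)
    finally show ?thesis by simp
  qed
  have "(\<Sum>u\<in>V. (g u)\<^sup>2) \<le> ?s * energy A n + (q * Q\<^sup>2 + Q) * M\<^sup>2"
    using sphere_convolution_le[of "rep A n"] sum_rep[OF AV, of n] rep_nonneg
    by (simp add: g_def energy_def M_def)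
  moreover have "(\<Sum>u\<in>V. (g u - c)\<^sup>2) = (\<Sum>u\<in>V. (g u)\<^sup>2) - 2 * c * (?s * M) + ?D * c\<^sup>2"
    unfolding sum_squared_deviation sum_g card_V q_d by simp
  \<comment> \<open>Both sides are the squared mean summed over \<open>V\<close>. Subtracted from
    \<open>(q Q^2 + Q) M^2\<close> it leaves at most \<open>3 Q M^2\<close>, which largeness turns
    into \<open>3 a M^2 / q\<close>.\<close>
  moreover have "2 * c * (?s * M) - ?D * c\<^sup>2 = (q * Q\<^sup>2 - 2 * Q + 1 / q) * M\<^sup>2"
  proof -
    have "?s\<^sup>2 / ?D = q * Q\<^sup>2 - 2 * Q + 1 / q"
      unfolding card_S using q0 by (simp add: field_simps power2_eq_square power3_eq_cube)
    moreover have "2 * c * (?s * M) - ?D * c\<^sup>2 = ?s\<^sup>2 / ?D * M\<^sup>2"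
      unfolding c_def using q0 by (simp add: field_simps power2_eq_square)
    ultimately show ?thesis by (simp only:)
  qed
  ultimately have "(\<Sum>u\<in>V. (g u - c)\<^sup>2) \<le> ?s * energy A n + (q * Q\<^sup>2 + Q) * M\<^sup>2 - (q * Q\<^sup>2 - 2 * Q + 1 / q) * M\<^sup>2"
    by linarith
  also have "\<dots> = ?s * energy A n + 3 * Q * M\<^sup>2 - M\<^sup>2 / q" by (simp add: algebra_simps)
  also have "\<dots> \<le> q\<^sup>2 * Q\<^sup>2 * energy A n + 3 * (?a * M\<^sup>2 / q)"
  proof -
    have "?s * energy A n \<le> q\<^sup>2 * Q\<^sup>2 * energy A n" using card_S_le energy_nonneg by (rule mult_right_mono)
    moreover have "Q * M\<^sup>2 \<le> ?a * M\<^sup>2 / q"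
    proof -
      have "q * Q * M\<^sup>2 \<le> ?a * M\<^sup>2" using large by (intro mult_right_mono) auto
      then show ?thesis using q0 by (simp add: field_simps)
    qed
    moreover have "M\<^sup>2 / q \<ge> 0" using q0 by simp
    ultimately show ?thesis by linarith
  qed
  finally have dev: "(\<Sum>u\<in>V. (g u - c)\<^sup>2) \<le> q\<^sup>2 * Q\<^sup>2 * energy A n + 3 * (?a * M\<^sup>2 / q)" .
  have "energy A (Suc n) = (\<Sum>u\<in>V. rep A (Suc n) u * rep A (Suc n) u)"
    by (simp only: energy_def power2_eq_square)
  also have "\<dots> \<le> (\<Sum>u\<in>V. rep A (Suc n) u * g u)"
    by (intro sum_mono mult_left_mono rep_le rep_nonneg)
  also have "\<dots> = (\<Sum>u\<in>V. rep A (Suc n) u * (g u - c)) + c * (\<Sum>u\<in>V. rep A (Suc n) u)"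
  proof -
    have "x * y = x * (y - c) + c * x" for x y :: real by (simp add: algebra_simps)
    then have "(\<Sum>u\<in>V. rep A (Suc n) u * g u) = (\<Sum>u\<in>V. rep A (Suc n) u * (g u - c) + c * rep A (Suc n) u)"
      by (intro sum.cong refl)
    then show ?thesis by (simp only: sum.distrib sum_distrib_left)
  qed
  \<comment> \<open>Weight 1 produces half of \<open>energy A (Suc n)\<close>, which is then
    absorbed on the left.\<close>
  also have "(\<Sum>u\<in>V. rep A (Suc n) u * (g u - c)) \<le> (1 * (\<Sum>u\<in>V. (rep A (Suc n) u)\<^sup>2) + (\<Sum>u\<in>V. (g u - c)\<^sup>2) / 1) / 2"
    by (rule sum_mult_le_weighted_squares) simp
  also have "\<dots> = energy A (Suc n) / 2 + (\<Sum>u\<in>V. (g u - c)\<^sup>2) / 2"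
    by (simp only: energy_def) simp
  finally have "energy A (Suc n) \<le> (\<Sum>u\<in>V. (g u - c)\<^sup>2) + 2 * (c * ?a ^ Suc n)"
    unfolding sum_rep[OF AV] by linarith
  moreover have "c * ?a ^ Suc n \<le> ?a * M\<^sup>2 / q"
  proof -
    have "c \<le> q\<^sup>2 * Q\<^sup>2 * M / ?D"
      unfolding c_def using q0 card_S_le by (intro divide_right_mono mult_right_mono) (auto simp: M_def)
    also have "\<dots> = M / q" using q0 by (simp add: field_simps power2_eq_square power3_eq_cube)
    finally have "c * (?a * M) \<le> M / q * (?a * M)" by (rule mult_right_mono) (simp add: M_def)
    then show ?thesis by (simp add: M_def power2_eq_square mult_ac)
  qed
  \<comment> \<open>The coefficient 5 is 3 from the variance plus 2 from the doubled mean
    term.\<close>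
  moreover have "x \<le> 5 * r + w" if "x \<le> D + 2 * p" "p \<le> r" "D \<le> w + 3 * r" for x D p r w :: real
    using that by linarith
  ultimately have "energy A (Suc n) \<le> 5 * (?a * M\<^sup>2 / q) + q\<^sup>2 * Q\<^sup>2 * energy A n" using dev by blast
  then show ?thesis unfolding Msq by simp
qed

text \<open>Fixing the last summand \<open>x\<close> and letting it range over all of \<open>S\<close> in the variance
  exploits that \<open>A\<close> lies on the sphere; this is where a factor \<open>q\<close> is gained over the estimate
  for general sets.\<close>

lemma pinned_second_moment_le:
  assumes A: "A \<subseteq> S" and large: "q * Q \<le> real (card A)"
  shows "(\<Sum>x\<in>A. \<Sum>t\<in>F. (\<Sum>u\<in>V. rep A n u * of_bool (nrm (vadd u x) = t))\<^sup>2) \<le>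
    3 * real (card A) ^ (2 * n + 1) / q + q\<^sup>2 * Q\<^sup>2 * energy A n"
proof -
  let ?a = "real (card A)" and ?s = "real (card S)"
  have AV: "A \<subseteq> V" using A S_D(1) by blast
  have q0: "q > 0" "Q > 0" using q_ge_3 by auto
  define M where "M = ?a ^ n"
  \<comment> \<open>\<open>N x t\<close> counts the \<open>n\<close>-tuples whose sum
    \<open>u\<close> makes \<open>u + x\<close> have norm \<open>t\<close>; for fixed
    \<open>x\<close> these counts add up to \<open>M\<close>.\<close>
  define N where "N x t = (\<Sum>u\<in>V. rep A n u * of_bool (nrm (vadd u x) = t))" for x t
  have Msq: "?a ^ (2 * n + 1) = ?a * M\<^sup>2" by (simp only: M_def power_even_eq[symmetric] power_Suc[symmetric] Suc_eq_plus1)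
  have sum_N: "(\<Sum>t\<in>F. N x t) = M" if "x \<in> V" for x
    unfolding N_def M_def using AV that by (rule sum_rep_nrm)
  have dev: "(\<Sum>t\<in>F. (N x t - M / q)\<^sup>2) = (\<Sum>t\<in>F. (N x t)\<^sup>2) - M\<^sup>2 / q" if x: "x \<in> V" for x
    unfolding sum_squared_deviation sum_N[OF x] card_carrier using q0
    by (simp add: power2_eq_square)
  have "(\<Sum>x\<in>S. \<Sum>t\<in>F. (N x t)\<^sup>2) = (\<Sum>y\<in>S \<times> F. (\<Sum>u\<in>V. rep A n u * of_bool (nrm (vadd u (fst y)) = snd y))\<^sup>2)"
    by (simp add: N_def sum.cartesian_product case_prod_unfold)
  also have "\<dots> \<le> ?s * (\<Sum>u\<in>V. (rep A n u)\<^sup>2) + (q * Q\<^sup>2 + Q) * (\<Sum>u\<in>V. rep A n u)\<^sup>2"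
  \<comment> \<open>Incidences are with pairs of a point \<open>x\<close> and a value
    \<open>t\<close>. For different \<open>b\<close> and \<open>c\<close>, equality of the norms of
    \<open>b + x\<close> and \<open>c + x\<close> is a linear condition on \<open>x\<close>.\<close>
  proof (rule weighted_collisions_le)
    fix b assume b: "b \<in> V"
    have "card {y \<in> S \<times> F. nrm (vadd b (fst y)) = snd y} \<le> card S"
      by (rule card_inj_on_le[where f = fst]) (auto intro!: inj_onI simp: prod_eq_iff)
    then show "real (card {y \<in> S \<times> F. nrm (vadd b (fst y)) = snd y}) \<le> ?s" by simp
    fix c assume c: "c \<in> V" and ne: "b \<noteq> c"
    let ?w = "vsub b c" and ?T = "{x \<in> S. nrm (vadd b x) = nrm (vadd c x)}"
    have w: "?w \<in> V" "?w \<noteq> vzero" using b c ne vsub_eq_zero_iff by auto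
    have "card {y \<in> S \<times> F. nrm (vadd b (fst y)) = snd y \<and> nrm (vadd c (fst y)) = snd y} \<le> card ?T"
      by (rule card_inj_on_le[where f = fst]) (auto intro!: inj_onI simp: prod_eq_iff)
    moreover have "real (card ?T) \<le> q * Q\<^sup>2 + Q"
    proof (rule card_quadric_section_le[OF w])
      fix x assume x: "x \<in> ?T"
      then have V: "x \<in> V" "nrm x = j" using S_D by auto
      let ?B = "dot b x \<oplus> dot b x" and ?C = "dot c x \<oplus> dot c x"
      have "(nrm b \<oplus> ?B) \<oplus> j = (nrm c \<oplus> ?C) \<oplus> j"
        using x nrm_vadd[OF b V(1)] nrm_vadd[OF c V(1)] V dot_comm[OF b V(1)] dot_comm[OF c V(1)] by simp
      then have eq: "nrm b \<oplus> ?B = nrm c \<oplus> ?C" using b c V by (subst (asm) add.right_cancel) auto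
      have "dot ?w x \<oplus> dot ?w x = ?B \<ominus> ?C"
        using b c V by (simp add: dot_simps minus_eq minus_add a_ac)
      also have "\<dots> = nrm c \<ominus> nrm b"
        using b c V eq by (intro sum_eq_sum_imp_minus_eq) auto
      finally show "dot ?w x \<oplus> dot ?w x = nrm c \<ominus> nrm b" .
    qed (use b c in auto)
    ultimately show "real (card {y \<in> S \<times> F. nrm (vadd b (fst y)) = snd y \<and> nrm (vadd c (fst y)) = snd y}) \<le> q * Q\<^sup>2 + Q"
      by linarith
  qed (use rep_nonneg q0 in auto)
  also have "\<dots> = ?s * energy A n + (q * Q\<^sup>2 + Q) * M\<^sup>2" by (simp add: energy_def sum_rep[OF AV] M_def)
  finally have NS: "(\<Sum>x\<in>S. \<Sum>t\<in>F. (N x t)\<^sup>2) \<le> ?s * energy A n + (q * Q\<^sup>2 + Q) * M\<^sup>2" .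
  have "(\<Sum>x\<in>A. \<Sum>t\<in>F. (N x t)\<^sup>2) = (\<Sum>x\<in>A. (\<Sum>t\<in>F. (N x t - M / q)\<^sup>2) + M\<^sup>2 / q)"
    using dev AV by (intro sum.cong) auto
  also have "\<dots> = (\<Sum>x\<in>A. \<Sum>t\<in>F. (N x t - M / q)\<^sup>2) + ?a * M\<^sup>2 / q" by (simp add: sum.distrib)
  \<comment> \<open>Centring comes before the passage from \<open>A\<close> to \<open>S\<close>, so
    that the main term \<open>M^2 / q\<close> is paid only for the points of
    \<open>A\<close>.\<close>
  also have "(\<Sum>x\<in>A. \<Sum>t\<in>F. (N x t - M / q)\<^sup>2) \<le> (\<Sum>x\<in>S. \<Sum>t\<in>F. (N x t - M / q)\<^sup>2)"
    using A by (intro sum_mono2 sum_nonneg) auto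
  also have "\<dots> = (\<Sum>x\<in>S. (\<Sum>t\<in>F. (N x t)\<^sup>2) - M\<^sup>2 / q)" using dev S_D(1) by (intro sum.cong) auto
  also have "\<dots> = (\<Sum>x\<in>S. \<Sum>t\<in>F. (N x t)\<^sup>2) - ?s * M\<^sup>2 / q" by (simp add: sum_subtractf)
  also have "?s * M\<^sup>2 / q = (q * Q\<^sup>2 - Q) * M\<^sup>2"
    unfolding card_S using q0 by (simp add: field_simps power2_eq_square)
  finally have "(\<Sum>x\<in>A. \<Sum>t\<in>F. (N x t)\<^sup>2) \<le> ?s * energy A n + (q * Q\<^sup>2 + Q) * M\<^sup>2 - (q * Q\<^sup>2 - Q) * M\<^sup>2 + ?a * M\<^sup>2 / q"
    using NS by linarith
  also have "\<dots> = ?s * energy A n + 2 * (Q * M\<^sup>2) + ?a * M\<^sup>2 / q" by (simp add: algebra_simps)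
  also have "\<dots> \<le> q\<^sup>2 * Q\<^sup>2 * energy A n + 2 * (?a * M\<^sup>2 / q) + ?a * M\<^sup>2 / q"
  proof (intro add_mono mult_left_mono order_refl)
    show "?s * energy A n \<le> q\<^sup>2 * Q\<^sup>2 * energy A n" using card_S_le energy_nonneg by (rule mult_right_mono)
    have "q * Q * M\<^sup>2 \<le> ?a * M\<^sup>2" using large by (intro mult_right_mono) auto
    then show "Q * M\<^sup>2 \<le> ?a * M\<^sup>2 / q" using q0 by (simp add: field_simps)
  qed simp
  finally show ?thesis unfolding Msq N_def by simp
qed

text \<open>Iterates \<open>energy_Suc_le\<close> from \<open>energy_two_le\<close>. In terms of
  \<open>s\<close>, which is at most 1, the factor \<open>q^2 Q^2\<close> is \<open>s^2 a^2\<close>,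
  so each step adds at most 5 to the main coefficient and multiplies the \<open>sqrt q\<close> term
  by \<open>s^2\<close>.\<close>

lemma energy_le:
  assumes A: "A \<subseteq> S" and large: "q * Q \<le> real (card A)"
  defines "s \<equiv> q * Q / real (card A)"
  shows "energy A (i + 2) \<le> (5 * real (i + 2) + 8 * sqrt q * s * (s\<^sup>2) ^ i) * real (card A) ^ (2 * i + 3) / q"
proof (induction i)
  let ?a = "real (card A)"
  have q0: "q > 0" "Q > 0" using q_ge_3 by auto
  have a0: "?a > 0" using large q0 by (meson less_le_trans mult_pos_pos)
  have s: "0 \<le> s" "s \<le> 1" "s * ?a = q * Q" using large a0 q0 by (simp_all add: s_def)
  case 0
  have "energy A 2 \<le> ?a ^ 3 / q + 8 * (sqrt q * Q) * ?a\<^sup>2" by (rule energy_two_le[OF A large])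
  also have "\<dots> = (1 + 8 * sqrt q * s) * ?a ^ 3 / q"
    unfolding s_def using q0 a0 by (simp add: field_simps power2_eq_square power3_eq_cube)
  \<comment> \<open>10 is \<open>5 (i + 2)\<close> at \<open>i = 0\<close>.\<close>
  also have "\<dots> \<le> (10 + 8 * sqrt q * s) * ?a ^ 3 / q"
    using q0 by (intro divide_right_mono mult_right_mono) auto
  finally show ?case by (simp add: numeral_3_eq_3 numeral_2_eq_2)
next
  let ?a = "real (card A)"
  have q0: "q > 0" "Q > 0" using q_ge_3 by auto
  have a0: "?a > 0" using large q0 by (meson less_le_trans mult_pos_pos)
  have s: "0 \<le> s" "s \<le> 1" "s * ?a = q * Q" using large a0 q0 by (simp_all add: s_def)
  case (Suc i)
  let ?c = "5 * real (i + 2) + 8 * sqrt q * s * (s\<^sup>2) ^ i" and ?z = "?a ^ (2 * i + 5) / q"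
  have qQ: "q\<^sup>2 * Q\<^sup>2 = s\<^sup>2 * ?a\<^sup>2" using s(3) by (simp flip: power_mult_distrib)
  have e1: "2 * (i + 2) + 1 = 2 * i + 5" and e3: "2 * Suc i + 3 = 2 * i + 5" by simp_all
  have "2 * i + 5 = 2 + (2 * i + 3)" by simp
  then have e2: "?a\<^sup>2 * ?a ^ (2 * i + 3) = ?a ^ (2 * i + 5)" by (simp only: power_add)
  have "energy A (Suc (i + 2)) \<le> 5 * ?a ^ (2 * (i + 2) + 1) / q + q\<^sup>2 * Q\<^sup>2 * energy A (i + 2)"
    by (rule energy_Suc_le[OF A large])
  also have "\<dots> \<le> 5 * ?a ^ (2 * (i + 2) + 1) / q + q\<^sup>2 * Q\<^sup>2 * (?c * ?a ^ (2 * i + 3) / q)"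
    using Suc q0 by (intro add_left_mono mult_left_mono) auto
  also have "\<dots> = 5 * ?z + s\<^sup>2 * ?c * ?z"
    unfolding qQ e1 e2[symmetric] by (simp add: mult_ac)
  also have "\<dots> \<le> (5 * real (Suc i + 2) + 8 * sqrt q * s * (s\<^sup>2) ^ Suc i) * ?z"
  proof -
    have "s\<^sup>2 \<le> 1" using s by (simp add: power_le_one)
    then have "s\<^sup>2 * real (i + 2) \<le> 1 * real (i + 2)" by (intro mult_right_mono) auto
    moreover have "s\<^sup>2 * ?c = 5 * (s\<^sup>2 * real (i + 2)) + 8 * sqrt q * s * (s\<^sup>2) ^ Suc i" by (simp add: algebra_simps)
    moreover have "real (Suc i + 2) = real (i + 2) + 1" by simp
    moreover have "5 + c \<le> 5 * r' + e" if "x \<le> 1 * r" "c = 5 * x + e" "r' = r + 1" for x r c e r' :: real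
      using that by linarith
    ultimately have "5 + s\<^sup>2 * ?c \<le> 5 * real (Suc i + 2) + 8 * sqrt q * s * (s\<^sup>2) ^ Suc i" by blast
    moreover have "0 \<le> ?z" using q0 by simp
    ultimately have "(5 + s\<^sup>2 * ?c) * ?z \<le> (5 * real (Suc i + 2) + 8 * sqrt q * s * (s\<^sup>2) ^ Suc i) * ?z"
      by (rule mult_right_mono)
    then show ?thesis by (simp only: distrib_right)
  qed
  finally show ?case by (simp only: add_Suc e3 times_divide_eq_right)
qed

text \<open>Of the \<open>i + 3\<close> summands the last is pinned and \<open>i + 2\<close> are
  free. The condition on \<open>s\<close> makes the energy term in
  \<open>pinned_second_moment_le\<close> no larger than \<open>a M^2 / q\<close>, so the second
  moment averages to at most \<open>4 M^2 / q\<close> over \<open>x\<close> in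
  \<open>A\<close>.\<close>

lemma card_Delta_ge:
  assumes A: "A \<subseteq> S" and large: "q * Q \<le> real (card A)"
  defines "s \<equiv> q * Q / real (card A)"
  assumes s: "5 * real (i + 2) * s\<^sup>2 + 8 * sqrt q * s ^ (2 * i + 3) \<le> 1"
  shows "q \<le> 4 * real (card (Delta R d (i + 3) A))"
proof -
  let ?a = "real (card A)" and ?n = "i + 2" and ?D = "Delta R d (i + 3) A"
  have AV: "A \<subseteq> V" using A S_D(1) by blast
  have q0: "q > 0" "Q > 0" using q_ge_3 by auto
  have a0: "?a > 0" using large q0 by (meson less_le_trans mult_pos_pos)
  have sa: "s * ?a = q * Q" using a0 by (simp add: s_def)
  define M where "M = ?a ^ ?n"
  define N where "N x t = (\<Sum>u\<in>V. rep A ?n u * of_bool (nrm (vadd u x) = t))" for x t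
  have Msq: "?a ^ (2 * ?n + 1) = ?a * M\<^sup>2" by (simp only: M_def power_even_eq[symmetric] power_Suc[symmetric] Suc_eq_plus1)
  have M0: "M > 0" using a0 by (simp add: M_def)
  have "q\<^sup>2 * Q\<^sup>2 * energy A ?n \<le> ?a * M\<^sup>2 / q"
  proof -
    have qQ: "q\<^sup>2 * Q\<^sup>2 = s\<^sup>2 * ?a\<^sup>2" using sa by (simp flip: power_mult_distrib)
    have "q\<^sup>2 * Q\<^sup>2 * energy A ?n \<le> s\<^sup>2 * ?a\<^sup>2 * ((5 * real (i + 2) + 8 * sqrt q * s * (s\<^sup>2) ^ i) * ?a ^ (2 * i + 3) / q)"
      unfolding qQ using energy_le[OF A large, of i] by (intro mult_left_mono) (simp_all add: s_def)
    also have "\<dots> = (5 * real (i + 2) * s\<^sup>2 + 8 * sqrt q * s ^ (2 * i + 3)) * (?a ^ (2 * ?n + 1) / q)"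
    proof -
      have "2 * ?n + 1 = 2 + (2 * i + 3)" "2 * i + 3 = 2 + Suc (2 * i)" by simp_all
      then have "?a ^ (2 * ?n + 1) = ?a\<^sup>2 * ?a ^ (2 * i + 3)" "s ^ (2 * i + 3) = s\<^sup>2 * (s * (s\<^sup>2) ^ i)"
        by (simp_all only: power_add power_Suc power_mult)
      then show ?thesis by (simp only:) (simp add: algebra_simps add_divide_distrib)
    qed
    also have "\<dots> \<le> 1 * (?a ^ (2 * ?n + 1) / q)" using s q0 by (intro mult_right_mono) auto
    finally show ?thesis unfolding Msq by simp
  qed
  moreover have "(\<Sum>x\<in>A. \<Sum>t\<in>F. (N x t)\<^sup>2) \<le> 3 * (?a * M\<^sup>2) / q + q\<^sup>2 * Q\<^sup>2 * energy A ?n"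
    unfolding N_def Msq[symmetric] by (rule pinned_second_moment_le[OF A large])
  moreover have "3 * (?a * M\<^sup>2) / q = 3 * (?a * M\<^sup>2 / q)" "?a * (4 * M\<^sup>2 / q) = 4 * (?a * M\<^sup>2 / q)"
    by simp_all
  ultimately have total: "(\<Sum>x\<in>A. \<Sum>t\<in>F. (N x t)\<^sup>2) \<le> ?a * (4 * M\<^sup>2 / q)" by linarith
  have "\<exists>x\<in>A. (\<Sum>t\<in>F. (N x t)\<^sup>2) \<le> 4 * M\<^sup>2 / q"
  proof (rule ccontr)
    assume "\<not> (\<exists>x\<in>A. (\<Sum>t\<in>F. (N x t)\<^sup>2) \<le> 4 * M\<^sup>2 / q)"
    then have less: "4 * M\<^sup>2 / q < (\<Sum>t\<in>F. (N x t)\<^sup>2)" if "x \<in> A" for x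
      using that not_le by blast
    have "finite A" "A \<noteq> {}" using a0 by (auto simp: card_gt_0_iff)
    then have "(\<Sum>x\<in>A. 4 * M\<^sup>2 / q) < (\<Sum>x\<in>A. \<Sum>t\<in>F. (N x t)\<^sup>2)"
      using less by (rule sum_strict_mono)
    then show False using total by simp
  qed
  then obtain x where x: "x \<in> A" "(\<Sum>t\<in>F. (N x t)\<^sup>2) \<le> 4 * M\<^sup>2 / q" by blast
  have xV: "x \<in> V" using x AV by blast
  \<comment> \<open>Adding the pinned \<open>x\<close> to a sum of \<open>i + 2\<close> points gives
    a sum of \<open>i + 3\<close>, so \<open>N x\<close> is supported on
    \<open>Delta\<close>.\<close>
  have DF: "t \<in> F \<Longrightarrow> N x t \<noteq> 0 \<Longrightarrow> t \<in> ?D" for t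
  proof -
    assume t: "t \<in> F" "N x t \<noteq> 0"
    from t(2)[unfolded N_def] obtain u where nz: "u \<in> V" "rep A ?n u * of_bool (nrm (vadd u x) = t) \<noteq> 0"
      by (rule sum.not_neutral_contains_not_neutral)
    then have u: "u \<in> V" "rep A ?n u \<noteq> 0" "nrm (vadd u x) = t"
      by (auto simp del: rep.simps split: if_splits)
    have "rep A (Suc ?n) (vadd u x) \<noteq> 0"
    proof -
      have "rep A ?n (vsub (vadd u x) x) \<le> rep A (Suc ?n) (vadd u x)"
        unfolding rep.simps(2) using x a0 card_ge_0_finite[of A]
        by (intro member_le_sum) (auto simp: rep_nonneg simp del: rep.simps)
      then have "rep A ?n u \<le> rep A (Suc ?n) (vadd u x)" by (simp only: vsub_vadd[OF u(1) xV])
      then show ?thesis using rep_nonneg[of A ?n u] u(2) by linarith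
    qed
    then have "\<exists>P. (\<forall>m\<in>{1..Suc ?n}. P m \<in> A) \<and> vec_sum R d (Suc ?n) P = vadd u x"
      using u xV by (intro rep_nonzero_vec_sum[OF AV]) simp_all
    moreover have "Suc ?n = i + 3" by simp
    ultimately obtain P where P: "\<forall>m\<in>{1..i + 3}. P m \<in> A" "vec_sum R d (i + 3) P = vadd u x"
      by (simp only:) blast
    show "t \<in> ?D" unfolding Delta_def using P u(3) by (intro CollectI exI[of _ P]) simp
  qed
  have DsubF: "?D \<subseteq> F"
  proof
    fix t assume "t \<in> ?D"
    then obtain P where P: "t = nrm (vec_sum R d (i + 3) P)" "\<forall>m\<in>{1..i + 3}. P m \<in> A" by (auto simp: Delta_def)
    then show "t \<in> F" using AV by (auto intro!: nrm_closed vec_sum_closed)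
  qed
  have fD: "finite ?D" using DsubF finite_subset finite_carrier by blast
  have "(\<Sum>t\<in>F. N x t) = M"
    unfolding N_def M_def using AV xV by (rule sum_rep_nrm)
  moreover have "(\<Sum>t\<in>F. N x t) = (\<Sum>t\<in>?D. N x t)"
    using DF DsubF by (intro sum.mono_neutral_right) auto
  ultimately have "M = (\<Sum>t\<in>?D. 1 * N x t)" by simp
  \<comment> \<open>With weight \<open>4 M / q\<close> the second half is at most
    \<open>M / 2\<close>, which is absorbed on the left.\<close>
  also have "\<dots> \<le> (4 * M / q * (\<Sum>t\<in>?D. 1\<^sup>2) + (\<Sum>t\<in>?D. (N x t)\<^sup>2) / (4 * M / q)) / 2"
    by (rule sum_mult_le_weighted_squares) (use M0 q0 in simp)
  also have "\<dots> \<le> (4 * M / q * real (card ?D) + (4 * M\<^sup>2 / q) / (4 * M / q)) / 2"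
  proof (intro divide_right_mono add_mono)
    have "(\<Sum>t\<in>?D. (N x t)\<^sup>2) \<le> (\<Sum>t\<in>F. (N x t)\<^sup>2)" using DsubF by (intro sum_mono2) auto
    then show "(\<Sum>t\<in>?D. (N x t)\<^sup>2) \<le> 4 * M\<^sup>2 / q" using x(2) by linarith
  qed (use M0 q0 in auto)
  also have "(4 * M\<^sup>2 / q) / (4 * M / q) = M" using M0 q0 by (simp add: power2_eq_square)
  finally have "q * M \<le> 4 * real (card ?D) * M" using q0 by (simp add: field_simps)
  then show ?thesis using M0 by simp
qed

end

section \<open>The main theorem\<close>

text \<open>For \<open>d = 4 l + 1\<close> the exponent \<open>m + 1 = 2 l\<close> is even, so the
  sign is 1 for either value of \<open>eta\<close> at -1; for \<open>d = 4 l - 1\<close> that value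
  is itself 1 because \<open>q\<close> is 1 modulo 4.\<close>

lemma elliptic_sphere_of_admissible:
  fixes R :: "'a ring"
  assumes "field R" "finite (carrier R)" "odd (order R)" "admissible d (order R)" "primitive_elem R j" "d \<ge> 3"
  shows "elliptic_sphere R d ((d - 3) div 2) j"
proof -
  interpret odd_finite_field R using assms by (simp add: odd_finite_field_def odd_finite_field_axioms_def)
  let ?m = "(d - 3) div 2"
  have e2: "eta (\<ominus>\<^bsub>R\<^esub> \<one>\<^bsub>R\<^esub>) * eta (\<ominus>\<^bsub>R\<^esub> \<one>\<^bsub>R\<^esub>) = 1" by (rule eta_nonzero) auto
  have "d = 2 * ?m + 3 \<and> eta (\<ominus>\<^bsub>R\<^esub> \<one>\<^bsub>R\<^esub>) ^ (?m + 1) = 1"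
    using assms(4) unfolding admissible_def
  proof
    assume "\<exists>l. d = 4 * l + 1"
    then obtain l where l: "d = 4 * l + 1" by blast
    then have "d = 2 * ?m + 3" "?m + 1 = 2 * l" using assms(6) by auto
    then show ?thesis using e2 by (metis power_mult power2_eq_square power_one)
  next
    assume h: "(\<exists>l. d + 1 = 4 * l) \<and> order R mod 4 = 1"
    then obtain l where "d + 1 = 4 * l" by blast
    then have "d = 2 * ?m + 3" using assms(6) by presburger
    then show ?thesis using eta_minus_one[OF assms(5)] h by simp
  qed
  then show ?thesis
    using primitive_nonsquare[OF assms(5)] odd_finite_field_axioms
    by (simp add: elliptic_sphere_def elliptic_sphere_axioms_def finite_field_vectors_def)
qed

text \<open>Covers both parts at once. The extra exponent \<open>\<epsilon>\<close> satisfies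
  \<open>\<epsilon> (2 k - 3) = 1/2\<close>, exactly what cancels \<open>sqrt q\<close> in the
  condition of \<open>card_Delta_ge\<close>, and \<open>C = 5 k + 8\<close> dominates the sum of its
  coefficients \<open>5 (k - 1)\<close> and 8.\<close>

lemma Delta_lower_bound:
  fixes R :: "'a ring" and d k :: nat
  assumes R: "field R" "finite (carrier R)" "odd (order R)" "admissible d (order R)" "primitive_elem R j"
    and d: "d \<ge> 3" and k: "k \<ge> 3" and A: "A \<subseteq> sphere R d j"
    and large: "real (card A) \<ge> (5 * real k + 8) *
      real (order R) powr ((real d - 1) / 2 + 1 / (4 * (real k - 3 / 2)))"
  shows "real (order R) \<le> 4 * real (card (Delta R d k A))"
proof -
  define m where "m = (d - 3) div 2"
  interpret elliptic_sphere R d m j unfolding m_def by (rule elliptic_sphere_of_admissible) (use R d in auto)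
  define C where "C = 5 * real k + 8"
  define \<epsilon> where "\<epsilon> = 1 / (4 * (real k - 3 / 2))"
  define s where "s = q * Q / real (card A)"
  obtain i where i: "k = i + 3" using k by (metis le_Suc_ex add.commute)
  have q0: "q > 0" "q \<ge> 1" using q_ge_3 by auto
  have C: "C \<ge> 1" by (simp add: C_def)
  have "(real d - 1) / 2 = real (m + 1)" using d_eq by simp
  then have "q powr ((real d - 1) / 2 + \<epsilon>) = q * Q * q powr \<epsilon>"
    using q0 by (simp add: powr_add powr_realpow flip: of_nat_Suc)
  then have a: "C * (q * Q * q powr \<epsilon>) \<le> real (card A)" using large by (simp add: C_def \<epsilon>_def)
  have e0: "\<epsilon> \<ge> 0" using i by (simp add: \<epsilon>_def)
  have qe: "q powr \<epsilon> \<ge> 1" using q0 e0 by (simp add: ge_one_powr_ge_zero)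
  \<comment> \<open>\<open>w\<close> is a lower bound for the ratio of the size of \<open>A\<close>
    to \<open>q Q\<close>, hence \<open>s\<close> is at most \<open>1 / w\<close>.\<close>
  define w where "w = C * q powr \<epsilon>"
  have w: "w \<ge> 1" "w \<ge> C" "w > 0"
    using mult_mono[of 1 C 1 "q powr \<epsilon>"] mult_left_mono[of 1 "q powr \<epsilon>" C] C qe by (auto simp: w_def)
  have qQ0: "q * Q > 0" using q0 by simp
  have aw: "w * (q * Q) \<le> real (card A)" using a by (simp add: w_def mult_ac)
  then have a0: "real (card A) > 0" using w(3) qQ0 by (meson less_le_trans mult_pos_pos)
  have big: "q * Q \<le> real (card A)" using aw mult_right_mono[OF w(1), of "q * Q"] qQ0 by simp
  have s: "0 \<le> s" "s \<le> 1 / w"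
    using aw w a0 qQ0 by (simp_all add: s_def field_simps)
  have s2: "s\<^sup>2 \<le> 1 / C"
  proof -
    have "s\<^sup>2 \<le> (1 / w)\<^sup>2" using s by (intro power_mono) auto
    also have "\<dots> \<le> 1 / w * 1" unfolding power2_eq_square using w by (intro mult_left_mono) auto
    also have "\<dots> \<le> 1 / C" using w C by (simp add: field_simps)
    finally show ?thesis .
  qed
  have s3: "sqrt q * s ^ (2 * i + 3) \<le> 1 / C"
  proof -
    have e: "\<epsilon> * real (2 * i + 3) = 1 / 2" using i by (simp add: \<epsilon>_def field_simps)
    have "(q powr \<epsilon>) ^ (2 * i + 3) = (q powr \<epsilon>) powr real (2 * i + 3)"
      by (rule powr_realpow[symmetric]) (use q0 in simp)
    also have "\<dots> = q powr (1 / 2)" by (simp only: powr_powr e)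
    finally have pw: "w ^ (2 * i + 3) = C ^ (2 * i + 3) * sqrt q"
      using q0 by (simp add: w_def power_mult_distrib powr_half_sqrt)
    have "sqrt q * s ^ (2 * i + 3) \<le> sqrt q * (1 / w) ^ (2 * i + 3)"
      using s by (intro mult_left_mono power_mono) auto
    also have "\<dots> = 1 / C ^ (2 * i + 3)" using q0 C by (simp only: power_divide pw) simp
    also have "\<dots> \<le> 1 / C"
      using C power_increasing[of 1 "2 * i + 3" C] by (intro divide_left_mono) auto
    finally show ?thesis .
  qed
  have "5 * real (i + 2) * s\<^sup>2 + 8 * sqrt q * s ^ (2 * i + 3) \<le> 5 * real (i + 2) * (1 / C) + 8 * (1 / C)"
    using s2 s3 by (intro add_mono mult_left_mono) auto
  also have "\<dots> = (5 * real (i + 2) + 8) / C" by (simp add: add_divide_distrib)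
  also have "\<dots> \<le> 1" using i by (simp add: C_def field_simps)
  finally show ?thesis using card_Delta_ge[OF A big, of i] i by (simp add: s_def)
qed

theorem theorem1p7:
  shows "\<exists>C1::real. C1 > 0 \<and> (\<forall>d::nat. d \<ge> 3 \<and> odd d \<longrightarrow>
    (\<forall>k::nat. k > 3 \<longrightarrow>
      (\<exists>C::real. C > 0 \<and>
        (\<forall>(R :: 'a ring) j A.
           field R \<and> finite (carrier R) \<and> odd (order R) \<and> admissible d (order R) \<and>
           primitive_elem R j \<and> A \<subseteq> sphere R d j \<and>
           real (card A) \<ge>
             C * real (order R) powr ((real d - 1) / 2 + 1 / (4 * (real k - 3 / 2))) \<longrightarrow>
           real (order R) \<le> C1 * real (card (Delta R d k A))))) \<and>
    (\<exists>C::real. C > 0 \<and>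
      (\<forall>(R :: 'a ring) j A.
         field R \<and> finite (carrier R) \<and> odd (order R) \<and> admissible d (order R) \<and>
         primitive_elem R j \<and> A \<subseteq> sphere R d j \<and>
         real (card A) \<ge> C * real (order R) powr (real d / 2 - 1 / 3) \<longrightarrow>
         real (order R) \<le> C1 * real (card (Delta R d 3 A)))))"
\<comment> \<open>4 is the constant of \<open>card_Delta_ge\<close>, independent of
  \<open>d\<close>, \<open>k\<close> and the field.\<close>
proof (rule exI[of _ "4::real"], intro conjI allI impI)
  fix d k :: nat
  assume "3 \<le> d \<and> odd d" "3 < k"
  then show "\<exists>C::real. C > 0 \<and>
        (\<forall>(R :: 'a ring) j A.
           field R \<and> finite (carrier R) \<and> odd (order R) \<and> admissible d (order R) \<and>
           primitive_elem R j \<and> A \<subseteq> sphere R d j \<and>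
           real (card A) \<ge>
             C * real (order R) powr ((real d - 1) / 2 + 1 / (4 * (real k - 3 / 2))) \<longrightarrow>
           real (order R) \<le> 4 * real (card (Delta R d k A)))"
    by (intro exI[of _ "5 * real k + 8"]) (auto intro!: Delta_lower_bound)
next
  fix d :: nat
  assume d: "3 \<le> d \<and> odd d"
  \<comment> \<open>At \<open>k = 3\<close> the extra exponent is \<open>1/6\<close>, so part (ii)
    is an instance of the same bound.\<close>
  have e: "real d / 2 - 1 / 3 = (real d - 1) / 2 + 1 / (4 * (real 3 - 3 / 2))" by (simp add: field_simps)
  show "\<exists>C::real. C > 0 \<and>
      (\<forall>(R :: 'a ring) j A.
         field R \<and> finite (carrier R) \<and> odd (order R) \<and> admissible d (order R) \<and>
         primitive_elem R j \<and> A \<subseteq> sphere R d j \<and>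
         real (card A) \<ge> C * real (order R) powr (real d / 2 - 1 / 3) \<longrightarrow>
         real (order R) \<le> 4 * real (card (Delta R d 3 A)))"
    unfolding e using d
    by (intro exI[of _ "5 * real 3 + 8"] conjI) (simp, blast intro: Delta_lower_bound)
qed simp

end
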